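(* Let $\lambda,\mu,\alpha,\beta>0$ and $p\in(0,1]$ satisfy $\lambda<\frac{\beta}{\alpha+\beta}\mu p$, and let $\pi$ be the stationary distribution of Model 2. Put $$s_p=(\mu p-\lambda-\beta-\alpha)^2+4\alpha\mu p,\qquad \gamma_p=\frac{2\lambda}{\lambda+\beta+\mu p+\alpha-\sqrt{s_p}}\in(0,1).$$ Then for every $y\in\mathbb N$ there are constants $C(U,y)>0$ and $C(D,y)>0$ (not depending on $k$) such that, as $k\to\infty$, $$\pi(k,y,U)\sim C(U,y)\,\gamma_p^k,\qquad \pi(k,y,D)\sim C(D,y)\,\gamma_p^k .$$
   Context: Notation: $n_k\sim m_k$ means $n_k/m_k\to1$ as $k\to\infty$; $\mathbb N=\{0,1,2,\dots\}$; $U$ = Up, $D$ = Down. Model 2: the continuous-time Markov chain on $\mathbb N\times\mathbb N\times\{U,D\}$ with states $(x,y,\sigma)$, where $x$ is the number of customers at the unreliable server 1, $y$ the number of customers at the reliable server 2, and $\sigma$ the status of server 1. Customers arrive at server 2 and, after service there, go to server 1 (joining its queue even when it is Down); after service at server 1 a customer leaves with probability $p$ and goes back to server 2 with probability $1-p$. The transition intensities are: $(x,y,\sigma)\to(x,y+1,\sigma)$ at rate $\lambda$; $(x,y,\sigma)\to(x+1,y-1,\sigma)$ at rate $\mu$ for $y\ge1$ and both values of $\sigma$; $(x,y,U)\to(x-1,y,U)$ at rate $\mu p$ and $(x,y,U)\to(x-1,y+1,U)$ at rate $\mu(1-p)$ for $x\ge1$; $(x,y,U)\to(x,y,D)$ at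 rate $\alpha$; $(x,y,D)\to(x,y,U)$ at rate $\beta$. Under $\lambda<\frac{\beta}{\alpha+\beta}\mu p$ it has a unique stationary distribution $\pi$. *)

theory Defs
  imports "HOL-Probability.Probability" "HOL-Library.Landau_Symbols"
begin

datatype status = Up | Down

type_synonym state = "nat \<times> nat \<times> status"

text \<open>
  The possible jumps lead to pairwise distinct targets, all different from the source, so at most
  one summand is nonzero and the diagonal entries are 0. The arguments are
  \<open>lam\<close> (arrivals), \<open>\<mu>\<close> (service), \<open>\<alpha>\<close> (breakdown), \<open>\<beta>\<close> (repair) and \<open>p\<close> (departure probability).
\<close>

fun rate :: "real \<Rightarrow> real \<Rightarrow> real \<Rightarrow> real \<Rightarrow> real \<Rightarrow> state \<Rightarrow> state \<Rightarrow> real" where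
  "rate lam \<mu> \<alpha> \<beta> p (x, y, \<sigma>) (x', y', \<sigma>') =
     (if x' = x \<and> y' = y + 1 \<and> \<sigma>' = \<sigma> then lam else 0)
   + (if y \<ge> 1 \<and> x' = x + 1 \<and> y' = y - 1 \<and> \<sigma>' = \<sigma> then \<mu> else 0)
   + (if x \<ge> 1 \<and> \<sigma> = Up \<and> x' = x - 1 \<and> y' = y \<and> \<sigma>' = Up then \<mu> * p else 0)
   + (if x \<ge> 1 \<and> \<sigma> = Up \<and> x' = x - 1 \<and> y' = y + 1 \<and> \<sigma>' = Up then \<mu> * (1 - p) else 0)
   + (if x' = x \<and> y' = y \<and> \<sigma> = Up \<and> \<sigma>' = Down then \<alpha> else 0)
   + (if x' = x \<and> y' = y \<and> \<sigma> = Down \<and> \<sigma>' = Up then \<beta> else 0)"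

text \<open>
  Global balance, i.e. \<open>\<pi> Q = 0\<close> for the generator \<open>Q\<close> with off-diagonal entries \<open>r\<close>. For the rates
  above, every state has only finitely many in- and out-neighbours, so both sums have finite support.
\<close>

definition stationary :: "('s \<Rightarrow> 's \<Rightarrow> real) \<Rightarrow> 's pmf \<Rightarrow> bool" where
  "stationary r \<pi> \<longleftrightarrow>
     (\<forall>s. (\<Sum>\<^sub>\<infinity>s'. pmf \<pi> s' * r s' s) = pmf \<pi> s * (\<Sum>\<^sub>\<infinity>s'. r s s'))"

definition s_p :: "real \<Rightarrow> real \<Rightarrow> real \<Rightarrow> real \<Rightarrow> real \<Rightarrow> real" where
  "s_p lam \<mu> \<alpha> \<beta> p = (\<mu> * p - lam - \<beta> - \<alpha>)\<^sup>2 + 4 * \<alpha> * \<mu> * p"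

definition gamma_p :: "real \<Rightarrow> real \<Rightarrow> real \<Rightarrow> real \<Rightarrow> real \<Rightarrow> real" where
  "gamma_p lam \<mu> \<alpha> \<beta> p = 2 * lam / (lam + \<beta> + \<mu> * p + \<alpha> - sqrt (s_p lam \<mu> \<alpha> \<beta> p))"

end

theory Submission
  imports Defs "HOL-Complex_Analysis.Great_Picard"
begin

text \<open>
  Let \<open>z = 1 / \<gamma>\<^sub>p\<close>. The function \<open>h (x, y, \<sigma>) = z\<^sup>x\<^sup>+\<^sup>y u(\<sigma>)\<close> with \<open>u\<close> a suitable eigenvector is
  harmonic for the chain except at the states \<open>(0, y, U)\<close>. Hence \<open>A = h \<pi>\<close> is, for \<open>x \<ge> 1\<close>, an
  invariant measure of a conservative walk that is homogeneous in \<open>x\<close>, and it suffices that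
  \<open>A(k, y, \<sigma>)\<close> has a positive limit. Lyapunov functions show that \<open>\<Sum>\<^sub>y A(0, y, U)\<close> is finite and
  that \<open>A(x, y, \<sigma>)\<close> decays geometrically in \<open>y\<close>, uniformly in \<open>x\<close>. The balance of \<open>h\<close> on
  \<open>{x + y \<le> N}\<close> shows that a positive combination of the sums of \<open>A(\<cdot>, \<cdot>, \<sigma>)\<close> over \<open>x + y = N\<close>
  increases with \<open>N\<close> to a positive limit.

  Convergence follows by compactness. For \<open>d(x) = A(x + 1) - A(x)\<close> the inflow of \<open>\<bar>d\<bar>\<close> minus its
  outflow is nonnegative, and its sum over all states with \<open>x \<ge> 1\<close> is bounded by fluxes through two
  columns. So it tends to \<open>0\<close>, and for every limit \<open>d'\<close> of shifts of \<open>d\<close> both \<open>d'\<close> and \<open>\<bar>d'\<bar>\<close> are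
  invariant. By irreducibility \<open>d'\<close> has constant sign, and as its level sums vanish, \<open>d' = 0\<close>. Thus
  limits of shifts of \<open>A\<close> do not depend on \<open>x\<close>, and the same argument applied to the difference of
  two of them shows that the limit is unique.
\<close>

section \<open>Invariant measures of homogeneous walks\<close>

lemma countable_UNIV_status [simp]: "countable (UNIV :: status set)"
proof -
  have "(UNIV :: status set) = {Up, Down}"
    using status.exhaust by auto
  moreover have "countable {Up, Down}" by simp
  ultimately show ?thesis by metis
qed

lemma sums_shift_zero:
  fixes h :: "nat \<Rightarrow> real"
  assumes "h sums S"
  shows "(\<lambda>y. if y = 0 then 0 else h (y - 1)) sums S"
proof -
  have "(\<lambda>y. if Suc y = 0 then 0 else h (Suc y - 1)) sums S"
    using assms by simp
  from sums_Suc[OF this] show ?thesis by simp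
qed

lemma mono_bounded_increments_tendsto_0:
  fixes G :: "nat \<Rightarrow> real"
  assumes "\<And>i. i \<ge> 1 \<Longrightarrow> G i \<le> G (Suc i)" and "\<And>i. \<bar>G i\<bar> \<le> M"
  shows "(\<lambda>i. G (Suc i) - G i) \<longlonglongrightarrow> 0"
proof -
  have "incseq (\<lambda>i. G (Suc i))"
    by (rule incseq_SucI) (simp add: assms(1))
  moreover have "\<forall>i. G (Suc i) \<le> M"
    using assms(2) abs_le_D1 by blast
  ultimately obtain L where "(\<lambda>i. G (Suc i)) \<longlonglongrightarrow> L"
    using incseq_convergent by metis
  then have "G \<longlonglongrightarrow> L"
    by (simp add: filterlim_sequentially_Suc)
  from tendsto_diff[OF \<open>(\<lambda>i. G (Suc i)) \<longlonglongrightarrow> L\<close> this] show ?thesis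
    by simp
qed

section \<open>Walks homogeneous in the first coordinate: defects and irreducibility\<close>

locale walk =
  fixes l \<mu> g q a b :: real
  assumes pos: "l > 0" "\<mu> > 0" "g > 0" "q \<ge> 0" "a > 0" "b > 0"
begin

text \<open>The jumps are (i, y) to (i, y + 1) at rate \<open>l\<close>, to (i + 1, y - 1) at rate
  \<open>\<mu>\<close> if y \<ge> 1, and from Up states to (i - 1, y) at rate \<open>g\<close> and
  to (i - 1, y + 1) at rate \<open>q\<close>; the status flips at rates \<open>a\<close> and
  \<open>b\<close>. The first coordinate is an integer because limits of shifts live on the whole
  line.\<close>

definition inflow :: "(int \<Rightarrow> nat \<Rightarrow> status \<Rightarrow> real) \<Rightarrow> int \<Rightarrow> nat \<Rightarrow> status \<Rightarrow> real" where
  "inflow f i y s = (if y = 0 then 0 else l * f i (y - 1) s) + \<mu> * f (i - 1) (y + 1) s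
     + (if s = Up
        then g * f (i + 1) y Up + (if y = 0 then 0 else q * f (i + 1) (y - 1) Up) + b * f i y Down
        else a * f i y Up)"

definition outrate :: "nat \<Rightarrow> status \<Rightarrow> real" where
  "outrate y s = l + (if y = 0 then 0 else \<mu>) + (if s = Up then g + q + a else b)"

definition invariant :: "(int \<Rightarrow> nat \<Rightarrow> status \<Rightarrow> real) \<Rightarrow> bool" where
  "invariant f \<longleftrightarrow> (\<forall>i y s. inflow f i y s = outrate y s * f i y s)"

definition defect :: "(int \<Rightarrow> nat \<Rightarrow> status \<Rightarrow> real) \<Rightarrow> int \<Rightarrow> nat \<Rightarrow> status \<Rightarrow> real" where
  "defect f i y s = inflow f i y s - outrate y s * f i y s"

lemma invariant_defect: "invariant f \<longleftrightarrow> (\<forall>i y s. defect f i y s = 0)"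
  by (simp add: invariant_def defect_def)

lemma outrate_pos: "outrate y s > 0"
  using pos by (auto simp: outrate_def intro!: add_pos_nonneg)

lemma defect_diff:
  "defect (\<lambda>i y s. f i y s - h i y s) i y s = defect f i y s - defect h i y s"
  by (simp add: defect_def inflow_def algebra_simps)

lemma defect_add:
  "defect (\<lambda>i y s. f i y s + h i y s) i y s = defect f i y s + defect h i y s"
  by (simp add: defect_def inflow_def algebra_simps)

lemma abs_inflow_le: "\<bar>inflow f i y s\<bar> \<le> inflow (\<lambda>i y s. \<bar>f i y s\<bar>) i y s"
proof -
  have m: "\<bar>u * f i y s\<bar> = u * \<bar>f i y s\<bar>" if "u \<ge> 0" for u i y s
    using that by (simp add: abs_mult)
  have "u \<ge> 0 \<Longrightarrow> \<bar>if P then 0 else u * x\<bar> = (if P then 0 else u * \<bar>x\<bar>)" for P and u x :: real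
    by (simp add: abs_mult)
  note m' = this[of l] this[of q]
  show ?thesis
    using pos unfolding inflow_def
    by (simp add: m[symmetric] m'[symmetric]) (smt (verit))
qed

text \<open>Triangle inequality: where \<open>f\<close> is balanced, the outflow of \<bar>f\<bar> is
  the absolute value of the inflow of \<open>f\<close>.\<close>

lemma defect_abs_nonneg:
  assumes "defect f i y s = 0"
  shows "defect (\<lambda>i y s. \<bar>f i y s\<bar>) i y s \<ge> 0"
proof -
  have "outrate y s * \<bar>f i y s\<bar> = \<bar>inflow f i y s\<bar>"
    using assms outrate_pos[of y s] by (simp add: defect_def abs_mult)
  then show ?thesis
    using abs_inflow_le[of f i y s] by (simp add: defect_def)
qed

lemma defect_tendsto:
  assumes "\<And>i y s. (\<lambda>j. f j i y s) \<longlonglongrightarrow> h i y s"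
  shows "(\<lambda>j. defect (f j) i y s) \<longlonglongrightarrow> defect h i y s"
  unfolding defect_def inflow_def by (auto intro!: tendsto_intros assms)

text \<open>Irreducibility: at a zero of \<open>f\<close> the inflow is zero, so \<open>f\<close>
  vanishes at every state with a jump into it, and such backward steps lead everywhere.\<close>

lemma invariant_zero:
  assumes inv: "invariant f" and nn: "\<And>i y s. f i y s \<ge> 0" and "f i y s = 0"
  shows "f i' y' s' = 0"
proof -
  have in0: "inflow f i y s = 0" if "f i y s = 0" for i y s
    using inv that by (simp add: invariant_def)
  have parts: "\<mu> * f (i - 1) (y + 1) s \<ge> 0" "l * f i (y - 1) s \<ge> 0" "g * f (i + 1) y Up \<ge> 0"
     "q * f (i + 1) (y - 1) Up \<ge> 0" "b * f i y Down \<ge> 0" "a * f i y Up \<ge> 0" for i y s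
    using pos nn by auto
  have diag: "f (i - 1) (y + 1) s = 0" if "f i y s = 0" for i y s
  proof -
    have "\<mu> * f (i - 1) (y + 1) s = 0"
      using in0[OF that] parts(1)[of i y s] parts(2)[of i y s] parts(3-)[of i y] unfolding inflow_def
      by (smt (verit))
    then show ?thesis using pos by simp
  qed
  have flip: "f i y s' = 0" if "f i y s = 0" for i y s s'
  proof (cases s)
    case Up
    have "b * f i y Down = 0"
      using in0[OF that] parts(1)[of i y s] parts(2)[of i y s] parts(3-)[of i y] Up unfolding inflow_def
      by (smt (verit))
    then show ?thesis using pos that Up by (cases s') auto
  next
    case Down
    have "a * f i y Up = 0"
      using in0[OF that] parts(1)[of i y s] parts(2)[of i y s] parts(3-)[of i y] Down
        status.distinct unfolding inflow_def
      by (smt (verit))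
    then show ?thesis using pos that Down by (cases s') auto
  qed
  have right: "f (i + 1) y s = 0" if "f i y s = 0" for i y s
  proof -
    have "g * f (i + 1) y Up = 0"
      using in0[OF flip[OF that, of Up]] parts(1)[of i y Up] parts(2)[of i y Up]
        parts(3-)[of i y] unfolding inflow_def
      by (smt (verit))
    then show ?thesis using pos flip[of "i + 1" y Up] by simp
  qed
  have down: "f i y s = 0" if "f i (Suc y) s = 0" for i y s
  proof -
    have "l * f i y s = 0"
      using in0[OF that] parts(1)[of i "Suc y" s] parts(2)[of i "Suc y" s] parts(3-)[of i "Suc y"]
        diff_Suc_1[of y] unfolding inflow_def
      by (smt (verit) nat.distinct)
    then show ?thesis using pos by simp
  qed
  have right': "f (i + int k) y s = 0" if "f i y s = 0" for i y s k
    using that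
  proof (induction k)
    case (Suc k)
    from right[OF Suc.IH[OF Suc.prems]] show ?case by (simp add: add.assoc add.commute[of 1])
  qed simp
  have down': "f i y s = 0" if "f i (y + k) s = 0" for i y s k
    using that
  proof (induction k)
    case (Suc k)
    then show ?case using down[of i "y + k" s] by simp
  qed simp
  have diag': "f (i - int k) (y + k) s = 0" if "f i y s = 0" for i y s k
    using that
  proof (induction k)
    case (Suc k)
    from diag[OF Suc.IH[OF Suc.prems]] show ?case by (simp add: diff_diff_eq add.commute[of 1])
  qed simp
  \<comment> \<open>The backward route goes up the diagonal to (i - k, y + k), right to column i',
    then down to height y'. This \<open>k\<close> ensures i - k \<le> i' and y' \<le> y + k.\<close>
  define k where "k = y' + nat \<bar>i - i'\<bar>"
  have "f (i - int k) (y + k) s' = 0"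
    by (rule diag'[OF flip[OF assms(3)]])
  then have "f (i - int k + int (nat (i' - (i - int k)))) (y + k) s' = 0"
    by (rule right')
  moreover have "i - int k + int (nat (i' - (i - int k))) = i'"
    unfolding k_def by auto
  ultimately have "f i' (y + k) s' = 0" by simp
  moreover have "y + k = y' + (k - y' + y)"
    unfolding k_def by simp
  ultimately show ?thesis using down'[of i' y' "k - y' + y" s'] by simp
qed

end

section \<open>Geometrically dominated functions: fluxes between columns and sign arguments\<close>

locale geometric_walk = walk +
  fixes C r :: real and c :: "status \<Rightarrow> real"
  assumes r: "0 < r" "r < 1" and c_pos: "\<And>s. c s > 0"
begin

definition dominated :: "(int \<Rightarrow> nat \<Rightarrow> status \<Rightarrow> real) \<Rightarrow> bool" where
  "dominated f \<longleftrightarrow> (\<forall>i y s. \<bar>f i y s\<bar> \<le> C * r ^ y)"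

definition level :: "(int \<Rightarrow> nat \<Rightarrow> status \<Rightarrow> real) \<Rightarrow> int \<Rightarrow> real" where
  "level f n = (\<Sum>y. c Up * f (n - int y) y Up + c Down * f (n - int y) y Down)"

lemma summable_geometric_bound: "summable (\<lambda>y. C * r ^ y)"
  using r by (intro summable_mult summable_geometric) simp

text \<open>The first index may depend on \<open>y\<close>, which covers columns and the diagonals
  used in \<open>level\<close> alike.\<close>

lemma dominated_summable:
  assumes "dominated f"
  shows "summable (\<lambda>y. f (i y) y s)" "summable (\<lambda>y. f (i y) (Suc y) s)"
proof -
  have le: "\<bar>f i y s\<bar> \<le> C * r ^ y" for i y s
    using assms by (simp add: dominated_def)
  show "summable (\<lambda>y. f (i y) y s)"
    by (rule summable_comparison_test[OF _ summable_geometric_bound]) (use le in auto)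
  have "summable (\<lambda>y. C * r ^ Suc y)"
    using summable_geometric_bound by (subst summable_Suc_iff)
  then show "summable (\<lambda>y. f (i y) (Suc y) s)"
    by (rule summable_comparison_test[rotated]) (use le[of _ "Suc _"] in \<open>auto simp del: power_Suc\<close>)
qed

lemma level_diff:
  assumes "dominated f" "dominated h"
  shows "level (\<lambda>i y s. f i y s - h i y s) n = level f n - level h n"
proof -
  have su: "summable (\<lambda>y. c Up * f (n - int y) y Up + c Down * f (n - int y) y Down)"
    if "dominated f" for f
    by (intro summable_add summable_mult dominated_summable(1)[OF that])
  show ?thesis
    unfolding level_def suminf_diff[OF su[OF assms(1)] su[OF assms(2)]]
    by (simp add: algebra_simps)
qed

text \<open>Net flow from column i to column i - 1: jumps to the left start from Up states only,
  jumps to the right only from heights y \<ge> 1, whence \<open>Suc y\<close>.\<close>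

definition flux :: "(int \<Rightarrow> nat \<Rightarrow> status \<Rightarrow> real) \<Rightarrow> int \<Rightarrow> real" where
  "flux f i = (g + q) * (\<Sum>y. f i y Up)
     - \<mu> * (\<Sum>y. f (i - 1) (Suc y) Up + f (i - 1) (Suc y) Down)"

text \<open>Arrivals and status flips stay inside a column and cancel in its sum; what remains is
  the flow through its two sides.\<close>

lemma defect_sums:
  assumes "dominated f"
  shows "(\<lambda>y. defect f i y Up + defect f i y Down) sums (flux f (i + 1) - flux f i)"
proof -
  note su = dominated_summable(1)[OF assms, of "\<lambda>_. _", THEN summable_sums]
  note su' = dominated_summable(2)[OF assms, of "\<lambda>_. _", THEN summable_sums]
  note sh = su[THEN sums_shift_zero]
  have pr: "(\<lambda>y. if y = 0 then 0 else f i y s) sums (\<Sum>y. f i (Suc y) s)" for i s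
    using su'[of i s] sums_Suc[of "\<lambda>y. if y = 0 then 0 else f i y s"] by simp
  \<comment> \<open>The sum of the two defects with the flip terms already cancelled, arranged in
    separately summable pieces.\<close>
  define X where "X y = l * (if y = 0 then 0 else f i (y - 1) Up)
     + l * (if y = 0 then 0 else f i (y - 1) Down)
     + \<mu> * (f (i - 1) (Suc y) Up) + \<mu> * (f (i - 1) (Suc y) Down)
     + g * f (i + 1) y Up + q * (if y = 0 then 0 else f (i + 1) (y - 1) Up)
     - l * f i y Up - l * f i y Down
     - \<mu> * (if y = 0 then 0 else f i y Up) - \<mu> * (if y = 0 then 0 else f i y Down)
     - (g + q) * f i y Up" for y
  have "X sums (l * (\<Sum>y. f i y Up) + l * (\<Sum>y. f i y Down)
     + \<mu> * (\<Sum>y. f (i - 1) (Suc y) Up) + \<mu> * (\<Sum>y. f (i - 1) (Suc y) Down)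
     + g * (\<Sum>y. f (i + 1) y Up) + q * (\<Sum>y. f (i + 1) y Up)
     - l * (\<Sum>y. f i y Up) - l * (\<Sum>y. f i y Down)
     - \<mu> * (\<Sum>y. f i (Suc y) Up) - \<mu> * (\<Sum>y. f i (Suc y) Down)
     - (g + q) * (\<Sum>y. f i y Up))"
    unfolding X_def by (intro sums_add sums_diff sums_mult su su' sh pr)
  moreover have "X = (\<lambda>y. defect f i y Up + defect f i y Down)"
    unfolding X_def defect_def inflow_def outrate_def by (auto simp: algebra_simps fun_eq_iff)
  moreover have "(\<Sum>y. f i (Suc y) Up + f i (Suc y) Down)
      = (\<Sum>y. f i (Suc y) Up) + (\<Sum>y. f i (Suc y) Down)" for i
    using dominated_summable(2)[OF assms, of "\<lambda>_. i"] by (simp add: suminf_add)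
  ultimately show ?thesis
    by (simp add: flux_def algebra_simps)
qed

lemma flux_bounded: "\<exists>M. \<forall>f i. dominated f \<longrightarrow> \<bar>flux f i\<bar> \<le> M"
proof (intro exI allI impI)
  fix f i assume f: "dominated f"
  have le: "\<bar>f i y s\<bar> \<le> C * r ^ y" for i y s
    using f by (simp add: dominated_def)
  have C0: "C \<ge> 0" using order.trans[OF abs_ge_zero le[of 0 0 Up]] by simp
  have le': "\<bar>f i (Suc y) s\<bar> \<le> C * r ^ y" for i y s
  proof -
    have "C * r ^ Suc y \<le> C * r ^ y"
      using C0 r by (intro mult_left_mono power_decreasing) auto
    with le[of i "Suc y" s] show ?thesis by linarith
  qed
  define K where "K = (\<Sum>y. C * r ^ y)"
  have 1: "\<bar>\<Sum>y. h y\<bar> \<le> K" if "\<And>y. \<bar>h y\<bar> \<le> C * r ^ y" for h :: "nat \<Rightarrow> real"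
    unfolding K_def using norm_suminf_le[of h "\<lambda>y. C * r ^ y"] that summable_geometric_bound
    by simp
  have 2: "(\<Sum>y. f i (Suc y) Up + f i (Suc y) Down)
      = (\<Sum>y. f i (Suc y) Up) + (\<Sum>y. f i (Suc y) Down)" for i
    using dominated_summable(2)[OF f, of "\<lambda>_. i"] by (simp add: suminf_add)
  have "\<bar>flux f i\<bar> \<le> \<bar>(g + q) * (\<Sum>y. f i y Up)\<bar>
     + (\<bar>\<mu> * (\<Sum>y. f (i - 1) (Suc y) Up)\<bar> + \<bar>\<mu> * (\<Sum>y. f (i - 1) (Suc y) Down)\<bar>)"
    unfolding flux_def 2 by (simp add: algebra_simps)
  also have "\<dots> \<le> (g + q) * K + (\<mu> * K + \<mu> * K)"
    unfolding abs_mult using pos by (intro add_mono mult_mono 1 le le') auto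
  finally show "\<bar>flux f i\<bar> \<le> (g + q) * K + (\<mu> * K + \<mu> * K)" .
qed

text \<open>From column 1 on, the column sums of the defect are nonnegative increments of the
  bounded flux. So the flux is monotone there, its increments tend to 0, and they dominate each
  single defect.\<close>

lemma defect_tendsto_0:
  assumes f: "dominated f" and nn: "\<And>i y s. i \<ge> 1 \<Longrightarrow> defect f i y s \<ge> 0"
  shows "(\<lambda>n. defect f (int n) y s) \<longlonglongrightarrow> 0"
proof -
  define G where "G n = flux f (int n)" for n
  obtain M where M: "\<And>n. \<bar>G n\<bar> \<le> M"
    using flux_bounded f unfolding G_def by blast
  have sums: "(\<lambda>y. defect f (int n) y Up + defect f (int n) y Down) sums (G (Suc n) - G n)" for n
    using defect_sums[OF f, of "int n"] by (simp add: G_def add.commute)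
  have le: "defect f (int n) y s \<le> G (Suc n) - G n" if "n \<ge> 1" for n
  proof -
    have "defect f (int n) y s \<le> defect f (int n) y Up + defect f (int n) y Down"
      using nn[of "int n" y] that by (cases s) auto
    also have "\<dots> = (\<Sum>y\<in>{y}. defect f (int n) y Up + defect f (int n) y Down)" by simp
    also have "\<dots> \<le> G (Suc n) - G n"
      using sums[of n] nn[of "int n"] that
      by (subst sums_unique[OF sums[of n]], intro sum_le_suminf) (auto simp: sums_iff)
    finally show ?thesis .
  qed
  have "(\<lambda>n. G (Suc n) - G n) \<longlonglongrightarrow> 0"
  proof (rule mono_bounded_increments_tendsto_0[OF _ M])
    fix n :: nat assume "n \<ge> 1"
    then show "G n \<le> G (Suc n)"
      using le[of n] nn[of "int n" y s] by simp
  qed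
  then show ?thesis
  proof (rule tendsto_sandwich[OF _ _ tendsto_const, rotated 2])
    show "\<forall>\<^sub>F n in sequentially. 0 \<le> defect f (int n) y s"
      using nn by (auto intro!: eventually_sequentiallyI[of 1])
    show "\<forall>\<^sub>F n in sequentially. defect f (int n) y s \<le> G (Suc n) - G n"
      using le by (auto intro!: eventually_sequentiallyI[of 1])
  qed
qed

text \<open>If \<open>f\<close> and \<open>\<bar>f\<bar>\<close> are both invariant, so are the positive and the negative part of \<open>f\<close>;
  by irreducibility one of them vanishes identically.\<close>

lemma invariant_abs_imp_zero:
  assumes f: "dominated f" and inv: "invariant f" "invariant (\<lambda>i y s. \<bar>f i y s\<bar>)"
    and lev: "\<And>n. level f n = 0"
  shows "f i y s = 0"
proof -
  have invp: "invariant (\<lambda>i y s. \<bar>f i y s\<bar> + f i y s)"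
    using inv by (simp add: invariant_defect defect_add)
  have invn: "invariant (\<lambda>i y s. \<bar>f i y s\<bar> - f i y s)"
    using inv by (simp add: invariant_defect defect_diff)
  have sign: "(\<forall>i y s. f i y s \<ge> 0) \<or> (\<forall>i y s. f i y s \<le> 0)"
  proof (cases "\<exists>i y s. f i y s > 0")
    case True
    then obtain i y s where "f i y s > 0" by blast
    then have "\<bar>f i y s\<bar> - f i y s = 0" by simp
    from invariant_zero[OF invn _ this] have "\<bar>f i y s\<bar> - f i y s = 0" for i y s by simp
    then show ?thesis by (metis abs_ge_zero diff_eq_eq add_0)
  next
    case False
    then show ?thesis by (meson not_less)
  qed
  \<comment> \<open>On the diagonal through (i, y) all terms have the same sign and their sum is 0,
    so each of them is 0.\<close>
  define n where "n = i + int y"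
  define h where "h = (\<lambda>y. c Up * f (n - int y) y Up + c Down * f (n - int y) y Down)"
  have "summable h"
    unfolding h_def by (intro summable_add summable_mult dominated_summable(1)[OF f])
  have "suminf h = 0"
    using lev[of n] by (simp add: level_def h_def)
  have "h y = 0"
  proof (cases "\<forall>i y s. f i y s \<ge> 0")
    case True
    then have "\<And>y. h y \<ge> 0" unfolding h_def using c_pos by (simp add: less_imp_le)
    then show ?thesis using suminf_eq_zero_iff[OF \<open>summable h\<close>] \<open>suminf h = 0\<close> by simp
  next
    case False
    with sign have "c s * f i y s \<le> 0" for i y s
      using c_pos[of s] by (simp add: mult_le_0_iff)
    then have "h y \<le> 0" for y
      unfolding h_def by (intro add_nonpos_nonpos)
    then have "- h y \<ge> 0" for y by simp
    then show ?thesis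
      using suminf_eq_zero_iff[OF summable_minus[OF \<open>summable h\<close>]] suminf_minus[OF \<open>summable h\<close>]
        \<open>suminf h = 0\<close> by simp
  qed
  then have eq: "c Up * f i y Up + c Down * f i y Down = 0"
    by (simp add: h_def n_def)
  have z: "u = 0 \<and> v = 0" if "c Up * u + c Down * v = 0" "u \<ge> 0 \<and> v \<ge> 0 \<or> u \<le> 0 \<and> v \<le> 0" for u v
  proof -
    from that(2) have "(c Up * u \<ge> 0 \<and> c Down * v \<ge> 0) \<or> (c Up * u \<le> 0 \<and> c Down * v \<le> 0)"
      using c_pos[of Up] c_pos[of Down] by (auto simp: mult_le_0_iff)
    with that(1) have "c Up * u = 0" "c Down * v = 0" by linarith+
    then show ?thesis using c_pos[of Up] c_pos[of Down] by simp
  qed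
  show ?thesis using z[OF eq] sign by (cases s) auto
qed

text \<open>For a translation invariant \<open>f\<close> the flux of \<bar>f\<bar> is the same
  through all columns. Hence the nonnegative defects of \<bar>f\<bar> sum to 0 over each column, and
  \<bar>f\<bar> is invariant too.\<close>

lemma limit_unique:
  assumes f: "dominated f" "invariant f" and tr: "\<And>i y s. f (i + 1) y s = f i y s"
    and lev: "\<And>n. level f n = 0"
  shows "f i y s = 0"
proof (rule invariant_abs_imp_zero[OF f _ lev])
  let ?h = "\<lambda>i y s. \<bar>f i y s\<bar>"
  have h: "dominated ?h" using f(1) by (simp add: dominated_def)
  have nn: "defect ?h i y s \<ge> 0" for i y s
    using f(2) by (intro defect_abs_nonneg) (simp add: invariant_defect)
  have "flux ?h (i + 1) = flux ?h i" for i
    using tr[of i] tr[of "i - 1"] by (simp add: flux_def)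
  then have s0: "(\<lambda>y. defect ?h i y Up + defect ?h i y Down) sums 0" for i
    using defect_sums[OF h, of i] by simp
  have "defect ?h i y Up + defect ?h i y Down = 0" for i y
    using suminf_eq_zero_iff[OF sums_summable[OF s0[of i]]] sums_unique[OF s0[of i]] nn by simp
  then have "defect ?h i y s = 0" for i y s
    using nn[of i y Up] nn[of i y Down] by (cases s) (smt (verit))+
  then show "invariant ?h" by (simp add: invariant_defect)
qed

end

section \<open>Limits of shifts and their uniqueness\<close>

locale stationary_walk = geometric_walk +
  fixes A :: "nat \<Rightarrow> nat \<Rightarrow> status \<Rightarrow> real" and F :: real
  assumes A: "\<And>x y s. 0 \<le> A x y s" "\<And>x y s. A x y s \<le> C * r ^ y"
    and balance: "\<And>x y s. x \<ge> 1 \<Longrightarrow> defect (\<lambda>i. A (nat i)) (int x) y s = 0"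
    and level_lim: "(\<lambda>n. \<Sum>y\<le>n. c Up * A (n - y) y Up + c Down * A (n - y) y Down) \<longlonglongrightarrow> F"
    and F: "F > 0"
begin

text \<open>For strictly increasing \<open>k\<close> the index \<open>int (k j) + i\<close> is
  eventually positive, so truncation by \<open>nat\<close> does not affect the limit
  \<open>B\<close>, which is defined on the whole line.\<close>

definition limit_along :: "(nat \<Rightarrow> nat) \<Rightarrow> (int \<Rightarrow> nat \<Rightarrow> status \<Rightarrow> real) \<Rightarrow> bool" where
  "limit_along k B \<longleftrightarrow> (\<forall>i y s. (\<lambda>j. A (nat (int (k j) + i)) y s) \<longlonglongrightarrow> B i y s)"

lemma C_nonneg: "C \<ge> 0"
  using A[of 0 0 Up] by simp

text \<open>Diagonal subsequence: the shifts of \<open>A\<close> are bounded by \<open>C\<close> on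
  a countable index set.\<close>

lemma limit_along_exists: "\<exists>(m :: nat \<Rightarrow> nat) B. strict_mono m \<and> limit_along (k \<circ> m) B"
proof -
  have "countable ((UNIV :: int set) \<times> (UNIV :: nat set) \<times> (UNIV :: status set))"
    by (intro countable_SIGMA) simp_all
  then have cnt: "countable (UNIV :: (int \<times> nat \<times> status) set)"
    by simp
  define f where "f = (\<lambda>(j::nat) (i, y, s). A (nat (int (k j) + i)) y s)"
  have bd: "norm (f j t) \<le> C" for j t
  proof (cases t)
    case (fields i y s)
    have "A (nat (int (k j) + i)) y s \<le> C * r ^ y" by (rule A)
    also have "\<dots> \<le> C * 1" using C_nonneg r by (intro mult_left_mono power_le_one) auto
    finally show ?thesis using A(1) fields by (simp add: f_def)
  qed
  obtain m where m: "strict_mono (m :: nat \<Rightarrow> nat)"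
    and lim: "\<And>t. t \<in> UNIV \<Longrightarrow> \<exists>L. (\<lambda>j. f (m j) t) \<longlonglongrightarrow> L"
    by (rule function_convergent_subsequence[OF cnt, of f C]) (use bd in auto)
  define L where "L t = (SOME L. (\<lambda>j. f (m j) t) \<longlonglongrightarrow> L)" for t
  have L: "(\<lambda>j. f (m j) t) \<longlonglongrightarrow> L t" for t
    unfolding L_def by (rule someI_ex) (simp add: lim)
  have "(\<lambda>j. A (nat (int (k (m j)) + i)) y s) \<longlonglongrightarrow> L (i, y, s)" for i y s
    using L[of "(i, y, s)"] by (simp add: f_def)
  then have "limit_along (k \<circ> m) (\<lambda>i y s. L (i, y, s))"
    unfolding limit_along_def by simp
  with m show ?thesis by blast
qed

context
  fixes k :: "nat \<Rightarrow> nat" and B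
  assumes k: "strict_mono k" and B: "limit_along k B"
begin

lemma limD: "(\<lambda>j. A (nat (int (k j) + i)) y s) \<longlonglongrightarrow> B i y s"
  using B by (simp add: limit_along_def)

lemma limit_nonneg: "B i y s \<ge> 0"
  by (rule LIMSEQ_le_const[OF limD]) (use A in auto)

lemma limit_dominated: "dominated B"
proof -
  have "B i y s \<le> C * r ^ y" for i y s
    by (rule LIMSEQ_le_const2[OF limD]) (use A in auto)
  then show ?thesis using limit_nonneg by (simp add: dominated_def)
qed

lemma eventually_ge: "\<forall>\<^sub>F j in sequentially. int (k j) + i \<ge> 1"
proof (rule eventually_sequentiallyI[of "nat (1 - i)"])
  fix j assume "j \<ge> nat (1 - i)"
  moreover have "k j \<ge> j" using k by (rule seq_suble)
  ultimately show "int (k j) + i \<ge> 1" by linarith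
qed

lemma defect_shift:
  "defect (\<lambda>i. f (n + i)) i y s = defect f (n + i) y s"
  unfolding defect_def inflow_def by (simp add: add_diff_eq add.assoc)

lemma limit_invariant: "invariant B"
  unfolding invariant_defect
proof (intro allI)
  fix i y s
  have "(\<lambda>j. defect (\<lambda>i. A (nat (int (k j) + i))) i y s) \<longlonglongrightarrow> defect B i y s"
    by (rule defect_tendsto) (rule limD)
  moreover have "\<forall>\<^sub>F j in sequentially. defect (\<lambda>i. A (nat (int (k j) + i))) i y s = 0"
    using eventually_ge[of i]
  proof eventually_elim
    case (elim j)
    have "defect (\<lambda>i. A (nat i)) (int (nat (int (k j) + i))) y s = 0"
      using elim by (intro balance) auto
    then show ?case
      using elim defect_shift[of "\<lambda>i. A (nat i)" "int (k j)" i y s] by simp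
  qed
  ultimately have "(\<lambda>j. 0) \<longlonglongrightarrow> defect B i y s"
    by (rule Lim_transform_eventually)
  then show "defect B i y s = 0" by (simp add: LIMSEQ_const_iff)
qed

text \<open>Dominated convergence: the level sums of \<open>A\<close> tend to \<open>F\<close>, and
  the bound \<open>C * r ^ y\<close> allows the limit to be taken inside the sum.\<close>

lemma limit_level: "level B n = F"
proof -
  define N where "N j = nat (int (k j) + n)" for j
  \<comment> \<open>Extension of the finite level sum by 0 beyond \<open>N j\<close>, so that
    Tannery's theorem applies to a full series.\<close>
  define e where "e y j = (if y \<le> N j then c Up * A (N j - y) y Up + c Down * A (N j - y) y Down else 0)"
    for y j
  have lim: "(\<lambda>j. e y j) \<longlonglongrightarrow> c Up * B (n - int y) y Up + c Down * B (n - int y) y Down" for y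
  proof (rule Lim_transform_eventually)
    show "(\<lambda>j. c Up * A (nat (int (k j) + (n - int y))) y Up
        + c Down * A (nat (int (k j) + (n - int y))) y Down)
      \<longlonglongrightarrow> c Up * B (n - int y) y Up + c Down * B (n - int y) y Down"
      by (intro tendsto_intros limD)
    show "\<forall>\<^sub>F j in sequentially. c Up * A (nat (int (k j) + (n - int y))) y Up
        + c Down * A (nat (int (k j) + (n - int y))) y Down = e y j"
      using eventually_ge[of "n - int y"]
    proof eventually_elim
      case (elim j)
      then have "y \<le> N j" "nat (int (k j) + (n - int y)) = N j - y"
        unfolding N_def by auto
      then show ?case by (simp add: e_def)
    qed
  qed
  have bd: "norm (e y j) \<le> (c Up + c Down) * (C * r ^ y)" for y j
  proof (cases "y \<le> N j")
    case True
    have "norm (e y j) \<le> c Up * (C * r ^ y) + c Down * (C * r ^ y)"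
      unfolding e_def using True A c_pos[THEN less_imp_le]
      by (auto simp: abs_mult intro!: order.trans[OF abs_triangle_ineq] add_mono mult_left_mono)
    then show ?thesis by (simp add: algebra_simps)
  next
    case False
    then show ?thesis using C_nonneg r c_pos[THEN less_imp_le] by (simp add: e_def)
  qed
  have "(\<lambda>j. \<Sum>y. e y j) \<longlonglongrightarrow> level B n"
    unfolding level_def
    using tannerys_theorem[of e _ sequentially "\<lambda>y. (c Up + c Down) * (C * r ^ y)", OF lim
        always_eventually summable_mult[OF summable_geometric_bound]] bd by simp
  moreover have "(\<Sum>y. e y j) = (\<Sum>y\<le>N j. c Up * A (N j - y) y Up + c Down * A (N j - y) y Down)" for j
    by (subst suminf_finite[of "{..N j}"]) (auto simp: e_def)
  ultimately have 1: "(\<lambda>j. \<Sum>y\<le>N j. c Up * A (N j - y) y Up + c Down * A (N j - y) y Down) \<longlonglongrightarrow> level B n"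
    by simp
  have "filterlim N at_top sequentially"
    unfolding filterlim_at_top
  proof
    fix Z
    show "\<forall>\<^sub>F j in sequentially. Z \<le> N j"
      using eventually_ge[of "n - int Z"] by eventually_elim (auto simp: N_def)
  qed
  from filterlim_compose[OF level_lim this] 1 show ?thesis
    using LIMSEQ_unique by blast
qed

lemma dominated_diff_A: "dominated (\<lambda>i y s. A (nat (i + 1)) y s - A (nat i) y s)"
  unfolding dominated_def
proof (intro allI)
  fix i y s
  show "\<bar>A (nat (i + 1)) y s - A (nat i) y s\<bar> \<le> C * r ^ y"
    using A(1)[of "nat (i + 1)" y s] A(2)[of "nat (i + 1)" y s] A(1)[of "nat i" y s] A(2)[of "nat i" y s]
    by linarith
qed

text \<open>The increments \<open>?D\<close> are balanced for i \<ge> 1, so the defect of their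
  absolute value is nonnegative there and tends to 0. In the limit both \<open>?E\<close> and its
  absolute value are invariant. As all levels of \<open>B\<close> equal \<open>F\<close>, those of
  \<open>?E\<close> are 0, and \<open>invariant_abs_imp_zero\<close> applies.\<close>

lemma limit_translation_invariant: "B (i + 1) y s = B i y s"
proof -
  let ?D = "\<lambda>i y s. A (nat (i + 1)) y s - A (nat i) y s"
  let ?E = "\<lambda>i y s. B (i + 1) y s - B i y s"
  have D0: "defect ?D i y s = 0" if "i \<ge> 1" for i y s
  proof -
    have "defect (\<lambda>i. A (nat (i + 1))) i y s = defect (\<lambda>i. A (nat i)) (i + 1) y s"
      using defect_shift[of "\<lambda>i. A (nat i)" 1 i y s] unfolding add.commute[of 1] .
    moreover have "defect (\<lambda>i. A (nat i)) (i + 1) y s = 0"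
      using balance[of "nat (i + 1)" y s] that by simp
    moreover have "defect (\<lambda>i. A (nat i)) i y s = 0"
      using balance[of "nat i" y s] that by simp
    ultimately show ?thesis by (simp add: defect_diff)
  qed
  have "dominated (\<lambda>i y s. \<bar>?D i y s\<bar>)"
    using dominated_diff_A by (simp add: dominated_def)
  then have T0: "(\<lambda>n. defect (\<lambda>i y s. \<bar>?D i y s\<bar>) (int n) y s) \<longlonglongrightarrow> 0" for y s
    by (rule defect_tendsto_0) (intro defect_abs_nonneg D0)
  have Dlim: "(\<lambda>j. ?D (int (k j) + i) y s) \<longlonglongrightarrow> ?E i y s" for i y s
    using tendsto_diff[OF limD[of "i + 1" y s] limD[of i y s]] by (simp add: add.assoc)
  have absinv: "invariant (\<lambda>i y s. \<bar>?E i y s\<bar>)"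
    unfolding invariant_defect
  proof (intro allI)
    fix i y s
    have 1: "(\<lambda>j. defect (\<lambda>i y s. \<bar>?D (int (k j) + i) y s\<bar>) i y s) \<longlonglongrightarrow> defect (\<lambda>i y s. \<bar>?E i y s\<bar>) i y s"
      by (rule defect_tendsto) (rule tendsto_rabs, rule Dlim)
    have "filterlim (\<lambda>j. nat (int (k j) + i)) at_top sequentially"
      unfolding filterlim_at_top
    proof
      fix Z
      show "\<forall>\<^sub>F j in sequentially. Z \<le> nat (int (k j) + i)"
        using eventually_ge[of "i - int Z"] by eventually_elim auto
    qed
    from filterlim_compose[OF T0 this]
    have 2: "(\<lambda>j. defect (\<lambda>i y s. \<bar>?D i y s\<bar>) (int (nat (int (k j) + i))) y s) \<longlonglongrightarrow> 0" .
    have "\<forall>\<^sub>F j in sequentially. defect (\<lambda>i y s. \<bar>?D i y s\<bar>) (int (nat (int (k j) + i))) y s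
        = defect (\<lambda>i y s. \<bar>?D (int (k j) + i) y s\<bar>) i y s"
      using eventually_ge[of i]
    proof eventually_elim
      case (elim j)
      then show ?case
        using defect_shift[of "\<lambda>i y s. \<bar>?D i y s\<bar>" "int (k j)" i y s] by simp
    qed
    from LIMSEQ_unique[OF Lim_transform_eventually[OF 2 this] 1]
    show "defect (\<lambda>i y s. \<bar>?E i y s\<bar>) i y s = 0" by simp
  qed
  have "defect (\<lambda>i. B (i + 1)) i y s = 0" for i y s
    using limit_invariant defect_shift[of B 1 i y s]
    unfolding invariant_defect add.commute[of 1] by simp
  then have "invariant ?E"
    using limit_invariant by (simp add: invariant_defect defect_diff)
  moreover have "dominated ?E"
    unfolding dominated_def
  proof (intro allI)
    fix i y s
    have "0 \<le> B i y s" "B i y s \<le> C * r ^ y" for i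
      using limit_nonneg limit_dominated by (auto simp: dominated_def abs_le_iff)
    from this[of i] this[of "i + 1"] show "\<bar>?E i y s\<bar> \<le> C * r ^ y" by linarith
  qed
  moreover have "level ?E n = 0" for n
  proof -
    have eq: "n - int y + 1 = n + 1 - int y" for y by simp
    have "level (\<lambda>i. B (i + 1)) n = level B (n + 1)"
      unfolding level_def by (simp only: eq)
    moreover have "dominated (\<lambda>i. B (i + 1))"
      using limit_dominated unfolding dominated_def by blast
    from level_diff[OF this limit_dominated]
    have "level ?E n = level (\<lambda>i. B (i + 1)) n - level B n" .
    ultimately have "level ?E n = level B (n + 1) - level B n"
      by (simp only:)
    then show ?thesis by (simp add: limit_level)
  qed
  ultimately have "?E i y s = 0"
    using invariant_abs_imp_zero[of ?E i y s] absinv by blast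
  then show ?thesis by simp
qed

lemma limit_pos: "B i y s > 0"
proof (rule ccontr)
  assume "\<not> B i y s > 0"
  then have "B i y s = 0" using limit_nonneg[of i y s] by simp
  from invariant_zero[OF limit_invariant limit_nonneg this]
  have "level B 0 = 0" by (simp add: level_def)
  then show False using limit_level[of 0] F by simp
qed

end

text \<open>Subsequence principle: values of \<open>A\<close> that stay away from
  \<open>B0 0 y s\<close> would have a shift limit along a further subsequence. By
  \<open>limit_unique\<close>, applied to the difference of two translation invariant limits, it
  equals \<open>B0\<close>, a contradiction.\<close>

theorem convergent_to_positive: "\<exists>L. \<forall>y s. L y s > 0 \<and> (\<lambda>k. A k y s) \<longlonglongrightarrow> L y s"
proof -
  obtain k0 B0 where k0: "strict_mono (k0 :: nat \<Rightarrow> nat)" and B0: "limit_along k0 B0"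
    using limit_along_exists[of id] by auto
  have uniq: "B i y s = B0 i y s" if k: "strict_mono k" "limit_along k B" for k B i y s
  proof -
    note props = limit_dominated[OF k] limit_dominated[OF k0 B0]
    let ?E = "\<lambda>i y s. B i y s - B0 i y s"
    have "?E i y s = 0"
    proof (rule limit_unique)
      show "dominated ?E"
        unfolding dominated_def
      proof (intro allI)
        fix i y s
        have "0 \<le> B i y s" "B i y s \<le> C * r ^ y" "0 \<le> B0 i y s" "B0 i y s \<le> C * r ^ y"
          using limit_nonneg[OF k] limit_nonneg[OF k0 B0] props by (auto simp: dominated_def abs_le_iff)
        then show "\<bar>?E i y s\<bar> \<le> C * r ^ y" by linarith
      qed
      show "invariant ?E"
        using limit_invariant[OF k] limit_invariant[OF k0 B0]
        by (simp add: invariant_defect defect_diff)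
      show "?E (i + 1) y s = ?E i y s" for i y s
        using limit_translation_invariant[OF k] limit_translation_invariant[OF k0 B0] by simp
      show "level ?E n = 0" for n
      proof -
        have "level ?E n = level B n - level B0 n"
          by (intro level_diff props)
        then show ?thesis by (simp add: limit_level[OF k] limit_level[OF k0 B0])
      qed
    qed
    then show ?thesis by simp
  qed
  have "(\<lambda>k. A k y s) \<longlonglongrightarrow> B0 0 y s" for y s
  proof (rule ccontr)
    assume "\<not> (\<lambda>k. A k y s) \<longlonglongrightarrow> B0 0 y s"
    then obtain e where e: "e > 0" and "\<not> (\<forall>\<^sub>F k in sequentially. dist (A k y s) (B0 0 y s) < e)"
      unfolding tendsto_iff by blast
    then have "\<exists>\<^sub>F k in sequentially. dist (A k y s) (B0 0 y s) \<ge> e"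
      by (simp add: frequently_def not_le)
    then have inf: "infinite {k. dist (A k y s) (B0 0 y s) \<ge> e}"
      by (simp add: cofinite_eq_sequentially[symmetric] frequently_cofinite)
    define k where "k = enumerate {k. dist (A k y s) (B0 0 y s) \<ge> e}"
    have k: "strict_mono k" and far: "dist (A (k j) y s) (B0 0 y s) \<ge> e" for j
      using strict_mono_enumerate[OF inf] enumerate_in_set[OF inf, of j] by (auto simp: k_def)
    obtain m B where m: "strict_mono m" "limit_along (k \<circ> m) B"
      using limit_along_exists by blast
    have "(\<lambda>j. A (nat (int (k (m j)) + 0)) y s) \<longlonglongrightarrow> B 0 y s"
      using m(2) unfolding limit_along_def o_def by blast
    then have "(\<lambda>j. A (k (m j)) y s) \<longlonglongrightarrow> B0 0 y s"
      using uniq[OF strict_mono_o[OF k m(1)] m(2)] by simp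
    then have "\<forall>\<^sub>F j in sequentially. dist (A (k (m j)) y s) (B0 0 y s) < e"
      using e by (rule tendstoD)
    then show False using far by (auto simp: eventually_sequentially not_less[symmetric])
  qed
  then show ?thesis using limit_pos[OF k0 B0] by blast
qed

end

section \<open>Stationarity and Lyapunov functions\<close>

lemma has_sum_if_eq:
  fixes c :: real
  shows "((\<lambda>t. if t = a then c else 0) has_sum c) UNIV"
proof -
  have "((\<lambda>t. if t = a then c else 0) has_sum (\<Sum>t\<in>{a}. if t = a then c else 0)) {a}"
    by (rule has_sum_finite) simp
  then have "((\<lambda>t. if t = a then c else 0) has_sum c) {a}" by simp
  then show ?thesis
    by (rule has_sum_cong_neutral[THEN iffD1, rotated -1]) auto
qed

lemma has_sum_if_image:
  fixes h :: "'b \<Rightarrow> real"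
  assumes "finite A" "inj_on \<phi> A"
  shows "((\<lambda>t. if t \<in> \<phi> ` A then h t else 0) has_sum (\<Sum>i\<in>A. h (\<phi> i))) UNIV"
proof -
  have "(h has_sum (\<Sum>t\<in>\<phi> ` A. h t)) (\<phi> ` A)"
    using assms(1) by (intro has_sum_finite) simp
  moreover have "(\<Sum>t\<in>\<phi> ` A. h t) = (\<Sum>i\<in>A. h (\<phi> i))"
    using assms(2) by (simp add: sum.reindex)
  ultimately have "(h has_sum (\<Sum>i\<in>A. h (\<phi> i))) (\<phi> ` A)" by simp
  then show ?thesis
    by (rule has_sum_cong_neutral[THEN iffD1, rotated -1]) auto
qed

lemma has_sum_diff_real:
  fixes f h :: "'a \<Rightarrow> real"
  assumes "(f has_sum a) A" "(h has_sum b) A"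
  shows "((\<lambda>x. f x - h x) has_sum (a - b)) A"
proof -
  have "((\<lambda>x. - h x) has_sum - b) A"
    using assms(2) by (simp add: has_sum_uminus)
  from has_sum_add[OF assms(1) this] show ?thesis by simp
qed

lemma sum_pmf_le_1: "finite S \<Longrightarrow> sum (pmf P) S \<le> 1"
  by (simp flip: measure_measure_pmf_finite)

lemma summable_pmf_bounded:
  fixes h :: "'a \<Rightarrow> real"
  assumes "\<And>s. \<bar>h s\<bar> \<le> M"
  shows "(\<lambda>s. pmf P s * h s) summable_on UNIV"
proof -
  have M: "M \<ge> 0" using order.trans[OF abs_ge_zero assms] .
  have "(\<Sum>s\<in>S. norm (pmf P s * h s)) \<le> M" if "finite S" for S
  proof -
    have "(\<Sum>s\<in>S. norm (pmf P s * h s)) \<le> (\<Sum>s\<in>S. pmf P s * M)"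
      using assms by (intro sum_mono) (simp add: abs_mult mult_left_mono)
    also have "\<dots> = sum (pmf P) S * M" by (simp add: sum_distrib_right)
    also have "\<dots> \<le> M" using sum_pmf_le_1[OF that, of P] M mult_right_mono[of _ 1 M] by simp
    finally show ?thesis .
  qed
  then have "(\<lambda>s. norm (pmf P s * h s)) summable_on UNIV"
    by (intro nonneg_bdd_above_summable_on) (auto intro!: bdd_aboveI[of _ M])
  then show ?thesis by (rule abs_summable_summable)
qed

section \<open>The chain of Model 2: generator, stationarity and drift\<close>

locale network =
  fixes lam \<mu> \<alpha> \<beta> p :: real and \<pi> :: "state pmf"
  assumes pos: "lam > 0" "\<mu> > 0" "\<alpha> > 0" "\<beta> > 0" "0 < p" "p \<le> 1"
    and stationary: "stationary (rate lam \<mu> \<alpha> \<beta> p) \<pi>"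
begin

text \<open>The off-diagonal part of the generator applied to a function: the sum of the rates out
  of a state times \<open>f\<close> at the target. So \<open>act (\<lambda>_. 1)\<close> is the
  total exit rate, and \<open>drift\<close> is the full generator.\<close>

fun act :: "(state \<Rightarrow> real) \<Rightarrow> state \<Rightarrow> real" where
  "act f (x, y, s) = lam * f (x, y + 1, s) + (if y = 0 then 0 else \<mu> * f (x + 1, y - 1, s))
     + (if x = 0 \<or> s = Down then 0 else \<mu> * p * f (x - 1, y, Up) + \<mu> * (1 - p) * f (x - 1, y + 1, Up))
     + (if s = Up then \<alpha> * f (x, y, Down) else \<beta> * f (x, y, Up))"

definition drift :: "(state \<Rightarrow> real) \<Rightarrow> state \<Rightarrow> real" where
  "drift f t = act f t - act (\<lambda>_. 1) t * f t"

lemma rate_nonneg: "rate lam \<mu> \<alpha> \<beta> p s t \<ge> 0"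
proof -
  have *: "c \<ge> 0 \<Longrightarrow> (if P then c else 0) \<ge> 0" for P and c :: real by simp
  have "\<mu> * p \<ge> 0" "\<mu> * (1 - p) \<ge> 0" using pos by simp_all
  then show ?thesis
    using pos by (cases s; cases t) (simp only: rate.simps, intro add_nonneg_nonneg *, simp_all)
qed

lemma act_has_sum: "((\<lambda>t. rate lam \<mu> \<alpha> \<beta> p s t * f t) has_sum act f s) UNIV"
proof (cases s)
  case (fields x y \<sigma>)
  \<comment> \<open>One indicator per kind of jump. For x = 0 or y = 0 the truncated differences x -
    1, y - 1 occur only with coefficient 0.\<close>
  let ?one = "\<lambda>a c t. if t = a then (c :: real) else 0"
  have "((\<lambda>t. ?one (x, y + 1, \<sigma>) (lam * f (x, y + 1, \<sigma>)) t
      + ?one (x + 1, y - 1, \<sigma>) (if y = 0 then 0 else \<mu> * f (x + 1, y - 1, \<sigma>)) t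
      + ?one (x - 1, y, Up) (if x = 0 \<or> \<sigma> = Down then 0 else \<mu> * p * f (x - 1, y, Up)) t
      + ?one (x - 1, y + 1, Up) (if x = 0 \<or> \<sigma> = Down then 0 else \<mu> * (1 - p) * f (x - 1, y + 1, Up)) t
      + ?one (x, y, Down) (if \<sigma> = Up then \<alpha> * f (x, y, Down) else 0) t
      + ?one (x, y, Up) (if \<sigma> = Up then 0 else \<beta> * f (x, y, Up)) t)
    has_sum (lam * f (x, y + 1, \<sigma>)
      + (if y = 0 then 0 else \<mu> * f (x + 1, y - 1, \<sigma>))
      + (if x = 0 \<or> \<sigma> = Down then 0 else \<mu> * p * f (x - 1, y, Up))
      + (if x = 0 \<or> \<sigma> = Down then 0 else \<mu> * (1 - p) * f (x - 1, y + 1, Up))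
      + (if \<sigma> = Up then \<alpha> * f (x, y, Down) else 0)
      + (if \<sigma> = Up then 0 else \<beta> * f (x, y, Up)))) UNIV" (is "(?g has_sum ?S) UNIV")
    by (intro has_sum_add has_sum_if_eq)
  moreover have "?g t = rate lam \<mu> \<alpha> \<beta> p s t * f t" for t
  proof (cases t)
    case t: (fields x' y' \<sigma>')
    show ?thesis
      unfolding t fields rate.simps distrib_right
      by (intro arg_cong2[where f = "(+)"]) (cases \<sigma>; auto)+
  qed
  moreover have "?S = act f s"
    by (simp add: fields)
  ultimately show ?thesis by simp
qed

lemma inflow_has_sum:
  "((\<lambda>t. pmf \<pi> t * rate lam \<mu> \<alpha> \<beta> p t (x, y, s)) has_sum
     ((if y = 0 then 0 else lam * pmf \<pi> (x, y - 1, s))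
      + (if x = 0 then 0 else \<mu> * pmf \<pi> (x - 1, y + 1, s))
      + (if s = Up then \<mu> * p * pmf \<pi> (x + 1, y, Up)
           + (if y = 0 then 0 else \<mu> * (1 - p) * pmf \<pi> (x + 1, y - 1, Up)) + \<beta> * pmf \<pi> (x, y, Down)
         else \<alpha> * pmf \<pi> (x, y, Up)))) UNIV"
proof -
  let ?one = "\<lambda>a c t. if t = a then (c :: real) else 0"
  let ?P = "pmf \<pi>"
  have "((\<lambda>t. ?one (x, y - 1, s) (if y = 0 then 0 else lam * ?P (x, y - 1, s)) t
      + ?one (x - 1, y + 1, s) (if x = 0 then 0 else \<mu> * ?P (x - 1, y + 1, s)) t
      + ?one (x + 1, y, Up) (if s = Up then \<mu> * p * ?P (x + 1, y, Up) else 0) t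
      + ?one (x + 1, y - 1, Up) (if s = Up \<and> y \<noteq> 0 then \<mu> * (1 - p) * ?P (x + 1, y - 1, Up) else 0) t
      + ?one (x, y, Up) (if s = Up then 0 else \<alpha> * ?P (x, y, Up)) t
      + ?one (x, y, Down) (if s = Up then \<beta> * ?P (x, y, Down) else 0) t)
    has_sum ((if y = 0 then 0 else lam * ?P (x, y - 1, s))
      + (if x = 0 then 0 else \<mu> * ?P (x - 1, y + 1, s))
      + (if s = Up then \<mu> * p * ?P (x + 1, y, Up) else 0)
      + (if s = Up \<and> y \<noteq> 0 then \<mu> * (1 - p) * ?P (x + 1, y - 1, Up) else 0)
      + (if s = Up then 0 else \<alpha> * ?P (x, y, Up))
      + (if s = Up then \<beta> * ?P (x, y, Down) else 0))) UNIV" (is "(?g has_sum ?S) UNIV")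
    by (intro has_sum_add has_sum_if_eq)
  moreover have "?g t = ?P t * rate lam \<mu> \<alpha> \<beta> p t (x, y, s)" for t
  proof (cases t)
    case t: (fields x' y' \<sigma>')
    show ?thesis
      unfolding t rate.simps distrib_left
      by (intro arg_cong2[where f = "(+)"]) (cases s; auto)+
  qed
  ultimately have "((\<lambda>t. ?P t * rate lam \<mu> \<alpha> \<beta> p t (x, y, s)) has_sum ?S) UNIV"
    by simp
  then show ?thesis
    by (rule back_subst[where P = "\<lambda>S. (_ has_sum S) UNIV"]) simp
qed

lemma balance_sums:
  "(\<Sum>\<^sub>\<infinity>t. pmf \<pi> t * rate lam \<mu> \<alpha> \<beta> p t s) = pmf \<pi> s * act (\<lambda>_. 1) s"
proof -
  have "(\<Sum>\<^sub>\<infinity>t. rate lam \<mu> \<alpha> \<beta> p s t) = act (\<lambda>_. 1) s"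
    using infsumI[OF act_has_sum[of s "\<lambda>_. 1"]] by simp
  then show ?thesis
    using stationary unfolding stationary_def by (metis (no_types))
qed

lemma global_balance:
  "(if y = 0 then 0 else lam * pmf \<pi> (x, y - 1, s))
      + (if x = 0 then 0 else \<mu> * pmf \<pi> (x - 1, y + 1, s))
      + (if s = Up then \<mu> * p * pmf \<pi> (x + 1, y, Up)
           + (if y = 0 then 0 else \<mu> * (1 - p) * pmf \<pi> (x + 1, y - 1, Up)) + \<beta> * pmf \<pi> (x, y, Down)
         else \<alpha> * pmf \<pi> (x, y, Up))
   = pmf \<pi> (x, y, s) * act (\<lambda>_. 1) (x, y, s)"
  using infsumI[OF inflow_has_sum[of x y s]] balance_sums[of "(x, y, s)"] by simp

lemma act_mono: "(\<And>t. f t \<le> h t) \<Longrightarrow> act f s \<le> act h s"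
  using pos by (cases s; simp only: act.simps; intro add_mono) (auto intro!: add_mono mult_left_mono)

lemma act_nonneg: "(\<And>t. f t \<ge> 0) \<Longrightarrow> act f s \<ge> 0"
  using pos by (cases s; simp only: act.simps; intro add_nonneg_nonneg) auto

lemma act_cmult: "act (\<lambda>t. k * f t) s = k * act f s"
  by (cases s) (simp add: algebra_simps)

lemma act_const: "act (\<lambda>_. k) s = k * act (\<lambda>_. 1) s"
  using act_cmult[of k "\<lambda>_. 1"] by simp

lemma abs_act_le: "\<bar>act f s\<bar> \<le> act (\<lambda>t. \<bar>f t\<bar>) s"
proof -
  have "act f s \<le> act (\<lambda>t. \<bar>f t\<bar>) s" by (rule act_mono) simp
  moreover have "act (\<lambda>t. - 1 * f t) s \<le> act (\<lambda>t. \<bar>f t\<bar>) s" by (rule act_mono) simp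
  ultimately show ?thesis unfolding act_cmult by simp
qed

lemma exit_rate: "0 \<le> act (\<lambda>_. 1) s" "act (\<lambda>_. 1) s \<le> lam + 2 * \<mu> + \<alpha> + \<beta>"
proof -
  show "0 \<le> act (\<lambda>_. 1) s" by (rule act_nonneg) simp
  have "\<mu> * p + \<mu> * (1 - p) = \<mu>" by (simp add: algebra_simps)
  then show "act (\<lambda>_. 1) s \<le> lam + 2 * \<mu> + \<alpha> + \<beta>"
    using pos by (cases s) simp
qed

text \<open>Fubini for the double sum of \<open>pmf \<pi> s * rate s t * f t\<close>: summing over t
  first gives the mean of \<open>act f\<close>, summing over s first gives, by stationarity, the
  mean of exit rate times \<open>f\<close>. Bounded \<open>f\<close> and bounded exit rates make the
  double sum absolutely convergent.\<close>

lemma expected_drift: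
  assumes bd: "\<And>s. \<bar>f s\<bar> \<le> M"
  shows "((\<lambda>s. pmf \<pi> s * drift f s) has_sum 0) UNIV"
proof -
  let ?r = "rate lam \<mu> \<alpha> \<beta> p"
  define \<Lambda> where "\<Lambda> = lam + 2 * \<mu> + \<alpha> + \<beta>"
  have M: "M \<ge> 0" using order.trans[OF abs_ge_zero bd] .
  have act_le: "\<bar>act f s\<bar> \<le> M * \<Lambda>" "\<bar>act (\<lambda>t. \<bar>f t\<bar>) s\<bar> \<le> M * \<Lambda>"
       "\<bar>act (\<lambda>_. 1) s * f s\<bar> \<le> \<Lambda> * M" for s
  proof -
    have "act (\<lambda>t. \<bar>f t\<bar>) s \<le> act (\<lambda>t. M) s" by (rule act_mono) (rule bd)
    also have "\<dots> \<le> M * \<Lambda>"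
      unfolding act_const[of M] \<Lambda>_def using exit_rate M by (intro mult_left_mono)
    finally have *: "act (\<lambda>t. \<bar>f t\<bar>) s \<le> M * \<Lambda>" .
    then show "\<bar>act f s\<bar> \<le> M * \<Lambda>" using abs_act_le[of f s] by linarith
    have "act (\<lambda>t. \<bar>f t\<bar>) s \<ge> 0" by (rule act_nonneg) simp
    with * show "\<bar>act (\<lambda>t. \<bar>f t\<bar>) s\<bar> \<le> M * \<Lambda>" by simp
    show "\<bar>act (\<lambda>_. 1) s * f s\<bar> \<le> \<Lambda> * M"
      unfolding abs_mult \<Lambda>_def using exit_rate[of s] bd[of s] by (intro mult_mono) auto
  qed
  let ?\<Phi> = "\<lambda>s t. pmf \<pi> s * ?r s t * f t"
  have inner: "((\<lambda>t. ?\<Phi> s t) has_sum (pmf \<pi> s * act f s)) UNIV" for s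
    using has_sum_cmult_right[OF act_has_sum[of s f], of "pmf \<pi> s"] by (simp add: mult.assoc)
  have inner_abs: "((\<lambda>t. norm (?\<Phi> s t)) has_sum (pmf \<pi> s * act (\<lambda>t. \<bar>f t\<bar>) s)) UNIV" for s
    using has_sum_cmult_right[OF act_has_sum[of s "\<lambda>t. \<bar>f t\<bar>"], of "pmf \<pi> s"] rate_nonneg
    by (simp add: mult.assoc abs_mult)
  have "(\<lambda>x. norm ((\<lambda>(s, t). ?\<Phi> s t) x)) summable_on UNIV \<times> UNIV"
  proof (rule Infinite_Sum.abs_summable_on_Sigma_iff[THEN iffD2], intro conjI ballI)
    fix s
    show "(\<lambda>t. norm (case (s, t) of (s, t) \<Rightarrow> ?\<Phi> s t)) summable_on UNIV"
      using inner_abs[of s] by (auto dest: has_sum_imp_summable)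
    have "(\<lambda>s. pmf \<pi> s * act (\<lambda>t. \<bar>f t\<bar>) s) summable_on UNIV"
      by (rule summable_pmf_bounded[OF act_le(2)])
    then have "(\<lambda>s. norm (pmf \<pi> s * act (\<lambda>t. \<bar>f t\<bar>) s)) summable_on UNIV"
      by (subst summable_on_iff_abs_summable_on_real[symmetric])
    then show "(\<lambda>s. norm (\<Sum>\<^sub>\<infinity>t. norm (case (s, t) of (s, t) \<Rightarrow> ?\<Phi> s t))) summable_on UNIV"
      unfolding prod.case infsumI[OF inner_abs] .
  qed
  then have "(\<lambda>(s, t). ?\<Phi> s t) summable_on UNIV \<times> UNIV"
    by (rule abs_summable_summable)
  from infsum_swap_banach[OF this]
  have "(\<Sum>\<^sub>\<infinity>s. pmf \<pi> s * act f s) = (\<Sum>\<^sub>\<infinity>t. \<Sum>\<^sub>\<infinity>s. ?\<Phi> s t)"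
    using infsumI[OF inner] by simp
  also have "\<dots> = (\<Sum>\<^sub>\<infinity>t. pmf \<pi> t * (act (\<lambda>_. 1) t * f t))"
    unfolding infsum_cmult_left' balance_sums by (simp add: mult.assoc)
  finally have eq: "(\<Sum>\<^sub>\<infinity>s. pmf \<pi> s * act f s) = (\<Sum>\<^sub>\<infinity>t. pmf \<pi> t * (act (\<lambda>_. 1) t * f t))" .
  have "((\<lambda>s. pmf \<pi> s * act f s - pmf \<pi> s * (act (\<lambda>_. 1) s * f s)) has_sum
     ((\<Sum>\<^sub>\<infinity>s. pmf \<pi> s * act f s) - (\<Sum>\<^sub>\<infinity>t. pmf \<pi> t * (act (\<lambda>_. 1) t * f t)))) UNIV"
    by (intro has_sum_diff_real has_sum_infsum summable_pmf_bounded[OF act_le(1)]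
        summable_pmf_bounded[OF act_le(3)])
  then show ?thesis
    unfolding eq by (simp add: drift_def right_diff_distrib)
qed

text \<open>Foster's criterion in integrated form. The test function \<open>f\<close> may be unbounded, so the drift
  identity is applied to its truncations.\<close>

lemma lyapunov:
  assumes nn: "\<And>s. f s \<ge> 0" "\<And>s. b s \<ge> 0" "\<And>s. h s \<ge> 0"
    and drift: "\<And>s. drift f s \<le> b s - h s"
    and bound: "\<And>S. finite S \<Longrightarrow> (\<Sum>s\<in>S. pmf \<pi> s * b s) \<le> K"
    and S: "finite S"
  shows "(\<Sum>s\<in>S. pmf \<pi> s * h s) \<le> K"
proof -
  have bsum: "(\<lambda>s. pmf \<pi> s * b s) summable_on UNIV"
    using bound nn(2) by (intro nonneg_bdd_above_summable_on) (auto intro!: bdd_aboveI[of _ K])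
  have bK: "(\<Sum>\<^sub>\<infinity>s. pmf \<pi> s * b s) \<le> K"
    using bound by (intro infsum_le_finite_sums[OF bsum])
  obtain n where n: "\<And>s. s \<in> S \<Longrightarrow> f s \<le> n"
    using finite_imageI[OF S, of f] by (metis Max_ge imageI)
  \<comment> \<open>\<open>n'\<close> bounds \<open>f\<close> on \<open>S\<close>, so the truncation
    agrees with \<open>f\<close> there.\<close>
  define n' where "n' = max n 0"
  define fn where "fn s = min (f s) n'" for s
  have "\<bar>fn s\<bar> \<le> n'" for s
    using nn(1)[of s] by (auto simp: fn_def n'_def)
  from expected_drift[OF this] have D: "((\<lambda>s. pmf \<pi> s * drift fn s) has_sum 0) UNIV" .
  have act1: "act fn s \<le> act f s" for s by (rule act_mono) (simp add: fn_def)
  have act2: "act fn s \<le> n' * act (\<lambda>_. 1) s" for s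
    unfolding act_const[of n', symmetric] by (rule act_mono) (simp add: fn_def)
  \<comment> \<open>Where \<open>f\<close> is not truncated, truncation can only lower the values at
    the targets of jumps; where it is, \<open>fn\<close> is at its maximum and its drift is
    nonpositive.\<close>
  have le_b: "drift fn s \<le> b s - (if s \<in> S then h s else 0)" for s
  proof (cases "f s \<le> n'")
    case True
    then have "fn s = f s" by (simp add: fn_def)
    then have "drift fn s \<le> drift f s" using act1[of s] by (simp add: drift_def)
    also have "\<dots> \<le> b s - h s" by (rule drift)
    finally show ?thesis using nn(3)[of s] by simp
  next
    case False
    then have "s \<notin> S" using n[of s] by (auto simp: n'_def)
    moreover have "fn s = n'" using False by (simp add: fn_def)
    ultimately show ?thesis using act2[of s] nn(2)[of s] by (simp add: drift_def mult.commute)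
  qed
  have "((\<lambda>s. pmf \<pi> s * b s - pmf \<pi> s * drift fn s) has_sum ((\<Sum>\<^sub>\<infinity>s. pmf \<pi> s * b s) - 0)) UNIV"
    by (intro has_sum_diff_real D has_sum_infsum bsum)
  moreover have "(\<Sum>s\<in>S. pmf \<pi> s * h s) \<le> (\<Sum>s\<in>S. pmf \<pi> s * b s - pmf \<pi> s * drift fn s)"
  proof (rule sum_mono)
    fix s assume "s \<in> S"
    then have "h s \<le> b s - drift fn s" using le_b[of s] by simp
    from mult_left_mono[OF this, of "pmf \<pi> s"]
    show "pmf \<pi> s * h s \<le> pmf \<pi> s * b s - pmf \<pi> s * drift fn s"
      by (simp add: right_diff_distrib)
  qed
  moreover have "(\<Sum>s\<in>S. pmf \<pi> s * b s - pmf \<pi> s * drift fn s) \<le> (\<Sum>\<^sub>\<infinity>s. pmf \<pi> s * b s) - 0"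
  proof (rule finite_sum_le_has_sum)
    show "((\<lambda>s. pmf \<pi> s * b s - pmf \<pi> s * drift fn s) has_sum (\<Sum>\<^sub>\<infinity>s. pmf \<pi> s * b s) - 0) UNIV"
      by fact
    show "0 \<le> pmf \<pi> s * b s - pmf \<pi> s * drift fn s" if "s \<in> UNIV - S" for s
      using le_b[of s] that mult_left_mono[of "drift fn s" "b s" "pmf \<pi> s"] by simp
  qed (use S in auto)
  ultimately show ?thesis using bK by linarith
qed

text \<open>For exponential weights each jump multiplies the weight by a constant, so the drift is
  the weight times a factor that sees \<open>x\<close> and \<open>y\<close> only through the
  boundary conditions.\<close>

lemma drift_monomial:
  assumes "X > 0" "Y > 0"
  shows "drift (\<lambda>(x, y, s). X ^ x * Y ^ y * v s) (x, y, s) = X ^ x * Y ^ y *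
    (lam * (Y - 1) * v s + (if y = 0 then 0 else \<mu> * (X / Y - 1) * v s)
     + (if x = 0 \<or> s = Down then 0 else (\<mu> * p * (1 / X - 1) + \<mu> * (1 - p) * (Y / X - 1)) * v Up)
     + (if s = Up then \<alpha> * (v Down - v Up) else \<beta> * (v Up - v Down)))"
proof -
  have X: "X ^ (x - 1) = X ^ x / X" if "x \<noteq> 0" using that assms by (cases x) auto
  have Y: "Y ^ (y - 1) = Y ^ y / Y" if "y \<noteq> 0" using that assms by (cases y) auto
  let ?H = "X ^ x * Y ^ y"
  have "act (\<lambda>(x, y, s). X ^ x * Y ^ y * v s) (x, y, s) = ?H *
    (lam * Y * v s + (if y = 0 then 0 else \<mu> * (X / Y) * v s)
     + (if x = 0 \<or> s = Down then 0 else (\<mu> * p * (1 / X) + \<mu> * (1 - p) * (Y / X)) * v Up)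
     + (if s = Up then \<alpha> * v Down else \<beta> * v Up))"
    using X Y by (cases s) (simp_all add: distrib_left mult_ac)
  then show ?thesis
    unfolding drift_def by (cases s) (simp_all add: algebra_simps)
qed

lemma drift_add: "drift (\<lambda>t. f t + h t) s = drift f s + drift h s"
  by (cases s) (simp add: drift_def algebra_simps)

end

section \<open>The root z, its eigenvector, and summability on the boundary x = 0\<close>

locale network_decay = network +
  fixes z \<rho> :: real
  assumes z: "1 < z" "lam * z < \<mu> * p" "lam * z < lam + \<beta>"
    and char_eq: "(\<mu> * p - lam * z) * (lam + \<beta> - lam * z) = \<alpha> * lam * z"
    and rho: "\<rho> = 1 - lam * (z - 1) / \<beta>"
begin

lemma rho_bounds: "0 < \<rho>" "\<rho> < 1"
  using pos z unfolding rho by (auto simp: field_simps)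

text \<open>With \<open>eigen_Up\<close>, this is harmonicity of the weight
  \<open>z ^ (x + y)\<close> times \<rho> at Up states and times 1 at Down states: its drift
  vanishes at all Down states and at Up states with x \<ge> 1.\<close>

lemma eigen_Down: "lam * (z - 1) + \<beta> * (\<rho> - 1) = 0"
  using pos unfolding rho by (simp add: field_simps)

lemma eigen_Up: "lam * (z - 1) * \<rho> + \<mu> * p * (1 / z - 1) * \<rho> + \<alpha> * (1 - \<rho>) = 0"
proof -
  have b: "\<beta> * \<rho> = lam + \<beta> - lam * z" "\<beta> * (1 - \<rho>) = lam * (z - 1)"
    using eigen_Down by (simp_all add: algebra_simps)
  have "z * \<beta> * (lam * (z - 1) * \<rho> + \<mu> * p * (1 / z - 1) * \<rho> + \<alpha> * (1 - \<rho>))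
     = z * lam * (z - 1) * (\<beta> * \<rho>) + \<mu> * p * (1 - z) * (\<beta> * \<rho>) + \<alpha> * z * (\<beta> * (1 - \<rho>))"
    using z by (simp add: field_simps)
  also have "\<dots> = (z - 1) * (\<alpha> * lam * z - (\<mu> * p - lam * z) * (lam + \<beta> - lam * z))"
    unfolding b by (simp add: algebra_simps)
  also have "\<dots> = 0" unfolding char_eq by simp
  finally show ?thesis using z pos by simp
qed

text \<open>Subtracting the equation at \<open>z\<close> leaves a multiple of z - t with a positive
  cofactor. The strict inequality gives room for an eigenvector with negative drift in
  \<open>boundary_summable\<close>.\<close>

lemma char_pos:
  assumes "t < z"
  shows "(\<mu> * p - lam * t) * (lam + \<beta> - lam * t) > \<alpha> * lam * t"
proof -
  have "(\<mu> * p - lam * t) * (lam + \<beta> - lam * t) - \<alpha> * lam * t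
     = (\<mu> * p - lam * t) * (lam + \<beta> - lam * t) - \<alpha> * lam * t
       - ((\<mu> * p - lam * z) * (lam + \<beta> - lam * z) - \<alpha> * lam * z)"
    using char_eq by simp
  also have "\<dots> = lam * (z - t) * ((\<mu> * p - lam * z) + (lam + \<beta> - lam * t) + \<alpha>)"
    by (simp add: algebra_simps)
  also have "\<dots> > 0"
  proof -
    have "lam * t < lam * z" using assms pos by simp
    then have "(\<mu> * p - lam * z) + (lam + \<beta> - lam * t) + \<alpha> > 0" using z pos by linarith
    then show ?thesis using pos assms by simp
  qed
  finally show ?thesis by simp
qed

text \<open>All conditions except \<open>z < w\<close> hold strictly at w = z, by 1 < z and
  \<open>lam * z < \<mu> * p\<close>, and persist slightly to the right of \<open>z\<close> by
  continuity.\<close>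

lemma exists_w:
  "\<exists>w. z < w \<and> lam * w < \<mu> * p \<and> p + (1 - p) * w < z \<and> \<mu> / w - lam - \<mu> * (1 - p) / z > 0"
proof -
  have 1: "((\<lambda>w. lam * w) \<longlongrightarrow> lam * z) (at_right z)"
    "((\<lambda>w. p + (1 - p) * w) \<longlongrightarrow> p + (1 - p) * z) (at_right z)"
    "((\<lambda>w. \<mu> / w - lam - \<mu> * (1 - p) / z) \<longlongrightarrow> \<mu> / z - lam - \<mu> * (1 - p) / z) (at_right z)"
    using z by (auto intro!: tendsto_intros)
  have "p * (z - 1) > 0" using pos z by simp
  then have "p + (1 - p) * z < z" by (simp add: algebra_simps)
  moreover have "\<mu> / z - lam - \<mu> * (1 - p) / z = (\<mu> * p - lam * z) / z"
    using z by (simp add: field_simps)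
  then have "\<mu> / z - lam - \<mu> * (1 - p) / z > 0" using z by simp
  ultimately have "\<forall>\<^sub>F w in at_right z. z < w \<and> lam * w < \<mu> * p \<and> p + (1 - p) * w < z
      \<and> \<mu> / w - lam - \<mu> * (1 - p) / z > 0"
    using order_tendstoD(2)[OF 1(1) z(2)] order_tendstoD(2)[OF 1(2)] order_tendstoD(1)[OF 1(3)]
      eventually_at_right_less[of z] by (intro eventually_conj)
  from eventually_happens'[OF _ this] show ?thesis by simp
qed

text \<open>The weight \<open>\<zeta>\<^sup>x w\<^sup>y\<close> with \<open>\<zeta> = p + (1 - p) w\<close> has negative drift, even at \<open>x = 0\<close>, except at
  \<open>y = 0\<close>, where its drift is of order \<open>\<zeta>\<^sup>x\<close>. This is compensated by the weight
  \<open>t\<^sup>x\<^sup>+\<^sup>y\<close> with \<open>\<zeta> < t < z\<close>, whose drift is negative except at \<open>x = 0\<close>.\<close>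

lemma boundary_summable:
  assumes w: "z < w" "lam * w < \<mu> * p" "p + (1 - p) * w < z"
  shows "summable (\<lambda>y. pmf \<pi> (0, y, Up) * w ^ y)"
proof -
  define \<zeta> where "\<zeta> = p + (1 - p) * w"
  define t where "t = (\<zeta> + z) / 2"
  have w1: "w > 1" using w z by simp
  have "\<zeta> = 1 + (1 - p) * (w - 1)" by (simp add: \<zeta>_def algebra_simps)
  then have zeta1: "\<zeta> \<ge> 1" using pos w1 by simp
  have "\<zeta> < z" using w by (simp add: \<zeta>_def)
  then have t: "1 < t" "t < z" "\<zeta> < t" using zeta1 z by (auto simp: t_def)
  \<comment> \<open>With status weights r (Up) and 1 (Down), the weight \<open>t ^ (x + y)\<close>
    has negative drift at Down states iff r < hi, and at Up states with x \<ge> 1 iff r > lo. At t =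
    z both bounds equal \<rho>; for t < z, \<open>char_pos\<close> opens the interval.\<close>
  define lo where "lo = \<alpha> / (\<alpha> + (\<mu> * p / t - lam) * (t - 1))"
  define hi where "hi = 1 - lam * (t - 1) / \<beta>"
  define r where "r = (lo + hi) / 2"
  have lamt: "lam * t < \<mu> * p" using t pos z by (smt (verit) mult_strict_left_mono)
  then have d: "\<mu> * p / t - lam > 0" using t by (simp add: field_simps)
  then have den: "\<alpha> + (\<mu> * p / t - lam) * (t - 1) > 0" using t pos by (simp add: add_pos_pos)
  have "lo < hi"
  proof -
    have "(\<beta> - lam * (t - 1)) * (\<alpha> * t + (\<mu> * p - lam * t) * (t - 1)) - \<alpha> * \<beta> * t
       = (t - 1) * ((\<mu> * p - lam * t) * (lam + \<beta> - lam * t) - \<alpha> * lam * t)"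
      by (simp add: algebra_simps)
    also have "\<dots> > 0" using char_pos[OF t(2)] t by simp
    finally have "\<alpha> * \<beta> * t < (\<beta> - lam * (t - 1)) * (\<alpha> * t + (\<mu> * p - lam * t) * (t - 1))" by simp
    also have "\<dots> = t * ((\<beta> - lam * (t - 1)) * (\<alpha> + (\<mu> * p / t - lam) * (t - 1)))"
      using t by (simp add: field_simps)
    finally have "\<alpha> * \<beta> < (\<beta> - lam * (t - 1)) * (\<alpha> + (\<mu> * p / t - lam) * (t - 1))"
      using t by (simp add: mult.commute)
    then have "lo < (\<beta> - lam * (t - 1)) / \<beta>"
      unfolding lo_def using den pos by (simp add: divide_simps mult.commute)
    also have "\<dots> = hi" using pos by (simp add: hi_def field_simps)
    finally show ?thesis .
  qed
  then have r: "lo < r" "r < hi" by (auto simp: r_def)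
  have "lo > 0" using den pos by (simp add: lo_def)
  then have r0: "r > 0" using r by simp
  have "lam * (t - 1) / \<beta> > 0" using pos t by simp
  then have r1: "r < 1" using r by (simp add: hi_def)
  define \<kappa>D where "\<kappa>D = - (lam * (t - 1) + \<beta> * (r - 1))"
  define \<kappa>U where "\<kappa>U = - (lam * (t - 1) * r + \<mu> * p * (1 / t - 1) * r + \<alpha> * (1 - r))"
  have "\<kappa>D > 0"
    using r pos by (simp add: \<kappa>D_def hi_def field_simps)
  have "\<kappa>U = r * (\<alpha> + (\<mu> * p / t - lam) * (t - 1)) - \<alpha>"
    unfolding \<kappa>U_def using t by (simp add: field_simps)
  also have "\<dots> > 0"
    using r den by (simp add: lo_def divide_simps mult.commute)
  finally have "\<kappa>U > 0" .
  define \<kappa> where "\<kappa> = min \<kappa>D \<kappa>U"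
  have kappa: "\<kappa> > 0" "\<kappa> \<le> \<kappa>D" "\<kappa> \<le> \<kappa>U"
    using \<open>\<kappa>D > 0\<close> \<open>\<kappa>U > 0\<close> by (auto simp: \<kappa>_def)
  \<comment> \<open>\<open>c\<close> is the decay rate of the drift of \<open>h\<close> at y \<ge>
    1. At y = 0 the service term is missing, and \<open>c'\<close> is the correction.\<close>
  define c where "c = (w - 1) * (\<mu> * p / w - lam)"
  have "\<mu> * p / w - lam > 0" using w w1 by (simp add: field_simps)
  then have c: "c > 0" using w1 by (simp add: c_def)
  define c' where "c' = c + lam * (w - 1)"
  have c': "c' > 0" using c pos w1 by (simp add: c'_def add_pos_pos)
  \<comment> \<open>Scaled so that the positive drift of \<open>f\<close> at the states (0, y, Up)
    uses up at most half of the decay of \<open>h\<close>.\<close>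
  define \<eta> where "\<eta> = c / (2 * (\<mu> * p))"
  have eta: "\<eta> > 0" "\<eta> * (\<mu> * p) = c / 2" using c pos by (simp_all add: \<eta>_def)
  define v where "v s = \<eta> * (if s = Up then r else 1)" for s
  define f where "f = (\<lambda>(x, y, s). t ^ x * t ^ y * v s)"
  define h where "h = (\<lambda>(x, y, s :: status). \<zeta> ^ x * w ^ y * (1 :: real))"
  have df: "drift f (x, y, s) \<le> - \<eta> * \<kappa> * (t ^ x * t ^ y) + (if x = 0 \<and> s = Up then c / 2 * w ^ y else 0)"
    for x y s
  proof -
    have D: "drift f (x, y, s) = t ^ x * t ^ y * \<eta> *
       (if s = Up then - \<kappa>U + (if x = 0 then \<mu> * p * (1 - 1 / t) * r else 0) else - \<kappa>D)"
      unfolding f_def using t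
      by (subst drift_monomial; cases s) (auto simp: v_def \<kappa>U_def \<kappa>D_def algebra_simps)
    have H: "t ^ x * t ^ y * \<eta> \<ge> 0" using t eta by simp
    have le: "- (t ^ x * t ^ y * \<eta>) * k \<le> - \<eta> * \<kappa> * (t ^ x * t ^ y)" if "k \<ge> \<kappa>" for k
      using mult_left_mono[OF that H] by (simp add: algebra_simps)
    show ?thesis
    proof (cases "x = 0 \<and> s = Up")
      case True
      have "(1 - 1 / t) * r \<le> 1 * 1" using t r0 r1 by (intro mult_mono) auto
      then have "\<mu> * p * ((1 - 1 / t) * r) \<le> \<mu> * p * 1" using pos by (intro mult_left_mono) auto
      then have "\<eta> * (\<mu> * p * (1 - 1 / t) * r) \<le> c / 2"
        unfolding eta(2)[symmetric] using eta(1) by (simp add: mult.assoc)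
      moreover have "t ^ y \<le> w ^ y" using t w by (intro power_mono) auto
      ultimately have "t ^ y * (\<eta> * (\<mu> * p * (1 - 1 / t) * r)) \<le> w ^ y * (c / 2)"
        using t r0 w1 c pos eta by (intro mult_mono) auto
      then show ?thesis unfolding D using True le[OF kappa(3)] by (simp add: algebra_simps)
    next
      case False
      then show ?thesis unfolding D using le[OF kappa(3)] le[OF kappa(2)] by auto
    qed
  qed
  have dh: "drift h (x, y, s) = - c * (\<zeta> ^ x * w ^ y) + (if y = 0 then c' * \<zeta> ^ x else 0)" for x y s
  proof -
    have z1: "\<mu> * (\<zeta> / w - 1) = - (w - 1) * (\<mu> * p / w)"
      using w1 by (simp add: \<zeta>_def field_simps)
    \<comment> \<open>This determines \<zeta>: service at server 1 leaves \<open>h\<close> unchanged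
      on average, so its absence at x = 0 or in status Down makes no difference.\<close>
    have z2: "\<mu> * p * (1 / \<zeta> - 1) + \<mu> * (1 - p) * (w / \<zeta> - 1) = 0"
    proof -
      have "\<mu> * p * (1 / \<zeta> - 1) + \<mu> * (1 - p) * (w / \<zeta> - 1) = \<mu> * ((p + (1 - p) * w) / \<zeta> - 1)"
        using zeta1 by (simp add: field_simps)
      then show ?thesis using zeta1 by (simp add: \<zeta>_def[symmetric])
    qed
    have "drift h (x, y, s) = \<zeta> ^ x * w ^ y * (lam * (w - 1)
        + (if y = 0 then 0 else - (w - 1) * (\<mu> * p / w)))"
      unfolding h_def using zeta1 w1 z1 z2 by (subst drift_monomial) auto
    moreover have "- (w - 1) * e = - ((w - 1) * (e - lam)) - lam * (w - 1)" for e
      by (simp add: algebra_simps)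
    from this[of "\<mu> * p / w"] have "- (w - 1) * (\<mu> * p / w) = - c - lam * (w - 1)"
      unfolding c_def .
    ultimately have "drift h (x, y, s) = \<zeta> ^ x * w ^ y * (if y = 0 then lam * (w - 1) else - c)"
      by simp
    then show ?thesis by (simp add: c'_def algebra_simps)
  qed
  have "(\<lambda>n. (\<zeta> / t) ^ n) \<longlonglongrightarrow> 0"
    using zeta1 t by (intro LIMSEQ_power_zero) auto
  then have "\<forall>\<^sub>F n in sequentially. (\<zeta> / t) ^ n < \<eta> * \<kappa> / c'"
    using eta kappa c' by (intro order_tendstoD) auto
  then obtain X0 where X0: "\<And>n. n \<ge> X0 \<Longrightarrow> (\<zeta> / t) ^ n < \<eta> * \<kappa> / c'"
    unfolding eventually_sequentially by blast
  \<comment> \<open>Beyond \<open>X0\<close> the term \<open>c' * \<zeta> ^ x\<close> is absorbed by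
    the decay of \<open>f\<close>, as \<zeta> < t; \<open>K\<close> covers the finitely many smaller
    x.\<close>
  define K where "K = c' * t ^ X0"
  have K: "c' * \<zeta> ^ x - \<eta> * \<kappa> * t ^ x \<le> K" for x
  proof (cases "x \<ge> X0")
    case True
    have "(\<zeta> / t) ^ x * c' \<le> \<eta> * \<kappa>"
      using X0[OF True] c' by (simp add: pos_less_divide_eq)
    then have "(\<zeta> / t) ^ x * c' * t ^ x \<le> \<eta> * \<kappa> * t ^ x"
      using t by (intro mult_right_mono) auto
    moreover have "(\<zeta> / t) ^ x * c' * t ^ x = c' * \<zeta> ^ x"
      using t by (simp add: power_divide)
    ultimately have "c' * \<zeta> ^ x \<le> \<eta> * \<kappa> * t ^ x" by simp
    moreover have "K \<ge> 0" using c' t by (simp add: K_def)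
    ultimately show ?thesis by simp
  next
    case False
    have "\<zeta> ^ x \<le> t ^ x" using zeta1 t by (intro power_mono) auto
    also have "t ^ x \<le> t ^ X0" using False t by (intro power_increasing) auto
    finally have "c' * \<zeta> ^ x \<le> K" using c' by (simp add: K_def)
    moreover have "\<eta> * \<kappa> * t ^ x \<ge> 0" using eta kappa t by simp
    ultimately show ?thesis by simp
  qed
  define g where "g = (\<lambda>(x, y, s :: status). c / 2 * (\<zeta> ^ x * w ^ y))"
  have ly: "(\<Sum>s\<in>S. pmf \<pi> s * g s) \<le> K" if S: "finite S" for S
  proof (rule lyapunov[where f = "\<lambda>t. f t + h t" and b = "\<lambda>_. K"])
    show "f s + h s \<ge> 0" for s
      using t zeta1 w1 eta r0 by (cases s) (simp add: f_def h_def v_def)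
    show K0: "K \<ge> 0" using c' t by (simp add: K_def)
    show "g s \<ge> 0" for s using zeta1 w1 c by (cases s) (simp add: g_def)
    show "(\<Sum>s\<in>S. pmf \<pi> s * K) \<le> K" if "finite S" for S
      using mult_right_mono[OF sum_pmf_le_1[OF that, of \<pi>] K0] by (simp add: sum_distrib_right)
    show "drift (\<lambda>t. f t + h t) s \<le> K - g s" for s
    proof (cases s)
      case (fields x y \<sigma>)
      have pw: "\<zeta> ^ x \<ge> 1" "w ^ y \<ge> 1" "t ^ x > 0" "t ^ y \<ge> 1" using zeta1 w1 t by auto
      have ek: "\<eta> * \<kappa> * (t ^ x * t ^ y) \<ge> 0" using eta kappa t by simp
      have "(if x = 0 \<and> \<sigma> = Up then c / 2 * w ^ y else 0) \<le> c / 2 * (\<zeta> ^ x * w ^ y)"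
        using pw c by auto
      moreover have "- \<eta> * \<kappa> * (t ^ x * t ^ y) + (if y = 0 then c' * \<zeta> ^ x else 0) \<le> K"
        using K[of x] ek K0 by auto
      moreover have "c * (\<zeta> ^ x * w ^ y) = c / 2 * (\<zeta> ^ x * w ^ y) + c / 2 * (\<zeta> ^ x * w ^ y)" by simp
      ultimately have "- \<eta> * \<kappa> * (t ^ x * t ^ y) + (if x = 0 \<and> \<sigma> = Up then c / 2 * w ^ y else 0)
          + (- c * (\<zeta> ^ x * w ^ y) + (if y = 0 then c' * \<zeta> ^ x else 0))
        \<le> K - c / 2 * (\<zeta> ^ x * w ^ y)"
        by linarith
      then show ?thesis
        unfolding drift_add fields dh g_def prod.case using df[of x y \<sigma>] by linarith
    qed
  qed (use S in auto)
  have "(\<Sum>y<n. pmf \<pi> (0, y, Up) * w ^ y) \<le> K * 2 / c" for n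
  proof -
    have "(\<Sum>s\<in>(\<lambda>y. (0, y, Up)) ` {..<n}. pmf \<pi> s * g s) \<le> K" by (rule ly) simp
    also have "(\<Sum>s\<in>(\<lambda>y. (0, y, Up)) ` {..<n}. pmf \<pi> s * g s) = c / 2 * (\<Sum>y<n. pmf \<pi> (0, y, Up) * w ^ y)"
      by (subst sum.reindex) (auto simp: inj_on_def g_def sum_distrib_left mult_ac)
    finally show ?thesis using c by (simp add: field_simps)
  qed
  then show ?thesis
    using w1 by (intro summableI_nonneg_bounded[where x = "K * 2 / c"]) auto
qed

end

section \<open>Level sums and geometric decay\<close>

text \<open>With truncated subtraction the exponent is the distance of x and N. Each side of N
  contributes at most one geometric series, so the bound is uniform in N.\<close>

lemma sum_two_sided_geometric:
  fixes \<theta> :: real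
  assumes "0 < \<theta>" "\<theta> < 1"
  shows "(\<Sum>x\<le>n. \<theta> ^ ((x - N) + (N - x))) \<le> 2 / (1 - \<theta>)"
proof -
  let ?f = "\<lambda>x. \<theta> ^ ((x - N) + (N - x))"
  have geo: "summable (\<lambda>i. \<theta> ^ i)" "(\<Sum>i. \<theta> ^ i) = 1 / (1 - \<theta>)"
    using assms by (auto intro!: summable_geometric suminf_geometric)
  have shift: "?f (i + N) = \<theta> ^ i" for i by simp
  have summ: "summable ?f"
    using geo(1) by (subst summable_iff_shift[of _ N, symmetric]) (simp only: shift)
  have "(\<Sum>x\<le>n. ?f x) \<le> suminf ?f"
    using assms by (intro sum_le_suminf summ) auto
  also have "\<dots> = 1 / (1 - \<theta>) + (\<Sum>i<N. ?f i)"
    using suminf_split_initial_segment[OF summ, of N] by (simp only: shift geo(2))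
  also have "(\<Sum>i<N. ?f i) \<le> (\<Sum>i<N. \<theta> ^ (N - Suc i))"
    using assms by (intro sum_mono power_decreasing) auto
  also have "\<dots> = (\<Sum>i<N. \<theta> ^ i)"
    by (rule sum.nat_diff_reindex)
  also have "\<dots> \<le> 1 / (1 - \<theta>)"
    unfolding geo(2)[symmetric] using assms by (intro sum_le_suminf geo(1)) auto
  finally show ?thesis by simp
qed

context network
begin

text \<open>Moves between the two servers preserve x + y, so only arrivals, departures and status
  flips contribute.\<close>

lemma drift_radial:
  "drift (\<lambda>(x, y, s). F (x + y) s) (x, y, s) = lam * (F (x + y + 1) s - F (x + y) s)
     + (if x = 0 \<or> s = Down then 0 else \<mu> * p * (F (x + y - 1) Up - F (x + y) Up))
     + (if s = Up then \<alpha> * (F (x + y) Down - F (x + y) Up) else \<beta> * (F (x + y) Up - F (x + y) Down))"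
proof -
  have "y \<noteq> 0 \<Longrightarrow> x + 1 + (y - 1) = x + y" "x \<noteq> 0 \<Longrightarrow> x - 1 + (y + 1) = x + y"
    "x \<noteq> 0 \<Longrightarrow> x - 1 + y = x + y - 1"
    by auto
  then have "act (\<lambda>(x, y, s). F (x + y) s) (x, y, s) = lam * F (x + y + 1) s
     + (if y = 0 then 0 else \<mu> * F (x + y) s)
     + (if x = 0 \<or> s = Down then 0 else \<mu> * p * F (x + y - 1) Up + \<mu> * (1 - p) * F (x + y) Up)
     + (if s = Up then \<alpha> * F (x + y) Down else \<beta> * F (x + y) Up)"
    by (simp only: act.simps prod.case add.assoc split: if_split) simp
  then show ?thesis
    unfolding drift_def by (cases s) (simp_all add: algebra_simps)
qed

end

section \<open>The measure rescaled by the harmonic weight\<close>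

context network_decay
begin

definition u :: "status \<Rightarrow> real" where "u s = (if s = Up then \<rho> else 1)"

definition A :: "nat \<Rightarrow> nat \<Rightarrow> status \<Rightarrow> real" where
  "A x y s = pmf \<pi> (x, y, s) * z ^ (x + y) * u s"

text \<open>The weights for which \<open>level_identity\<close> holds: at level N the cutoff of the
  harmonic weight replaces the gain from arrivals by a loss, and \<open>c s\<close> measures the
  difference.\<close>

definition c :: "status \<Rightarrow> real" where
  "c s = (if s = Up then lam * (z - 1) else lam * (z - \<rho>))"

lemma u_bounds: "0 < u s" "u s \<le> 1"
  using rho_bounds by (auto simp: u_def)

lemma A_nonneg: "A x y s \<ge> 0"
  using u_bounds[of s] z by (simp add: A_def)

lemma c_pos: "c s > 0"
  using pos z rho_bounds by (simp add: c_def)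

text \<open>The mean drift of the harmonic weight, cut off above level N, is 0. Its drift survives
  only at the states (0, y, Up), where departures are missing, and on level N, where arrivals meet
  the cutoff.\<close>

lemma level_identity:
  "(\<Sum>y\<le>N. c Up * A (N - y) y Up + c Down * A (N - y) y Down)
     = \<mu> * p * (1 - 1 / z) * (\<Sum>y\<le>N. A 0 y Up)"
proof -
  \<comment> \<open>The subtracted constant does not change the drift below level N and gives
    \<open>F N Up = 0\<close>, so departures from level N + 1 contribute nothing.\<close>
  define F where "F n s = (if n \<le> N then z ^ n * u s - z ^ N * \<rho> else 0)" for n s
  define f where "f = (\<lambda>(x, y, s). F (x + y) s)"
  define k where "k = \<mu> * p * (1 - 1 / z)"
  have bd: "\<bar>f t\<bar> \<le> z ^ N + z ^ N" for t
  proof (cases t)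
    case (fields x y s)
    have "\<bar>F n s\<bar> \<le> z ^ N + z ^ N" for n
    proof (cases "n \<le> N")
      case True
      have "z ^ n * u s \<le> z ^ N * 1"
        using True z u_bounds[of s] by (intro mult_mono power_increasing) auto
      moreover have "z ^ N * \<rho> \<le> z ^ N * 1"
        using z rho_bounds by (intro mult_left_mono) auto
      moreover have "z ^ n * u s \<ge> 0" "z ^ N * \<rho> \<ge> 0"
        using z rho_bounds u_bounds[of s] by auto
      ultimately show ?thesis using True by (simp add: F_def abs_le_iff)
    qed (use z in \<open>simp add: F_def\<close>)
    then show ?thesis by (simp add: f_def fields)
  qed
  have df: "drift f (x, y, s) = (if x = 0 \<and> s = Up \<and> y \<le> N then k * \<rho> * z ^ y else 0)
      - (if x + y = N then z ^ N * u s * c s else 0)" for x y s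
  proof -
    define n where "n = x + y"
    have d: "drift f (x, y, s) = lam * (F (n + 1) s - F n s)
     + (if x = 0 \<or> s = Down then 0 else \<mu> * p * (F (n - 1) Up - F n Up))
     + (if s = Up then \<alpha> * (F n Down - F n Up) else \<beta> * (F n Up - F n Down))"
      unfolding f_def drift_radial n_def ..
    show ?thesis
    proof (cases "n \<le> N")
      case True
      have t1: "lam * (F (n + 1) s - F n s) = z ^ n * (lam * (z - 1) * u s)
          - (if n = N then z ^ N * u s * c s else 0)"
        using True by (cases s) (auto simp: F_def u_def c_def algebra_simps)
      have t2: "\<mu> * p * (F (n - 1) Up - F n Up) = - (z ^ n * (k * \<rho>))" if "x \<noteq> 0"
      proof -
        from that have "n \<noteq> 0" by (simp add: n_def)
        then have "z ^ (n - 1) = z ^ n / z" using z by (cases n) auto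
        moreover have "n - 1 \<le> N" using True by simp
        ultimately show ?thesis using True by (simp add: F_def u_def k_def algebra_simps)
      qed
      have t3: "\<alpha> * (F n Down - F n Up) = z ^ n * (\<alpha> * (1 - \<rho>))"
        "\<beta> * (F n Up - F n Down) = z ^ n * (\<beta> * (\<rho> - 1))"
        using True by (simp_all add: F_def u_def algebra_simps)
      have "lam * (z - 1) * \<rho> + \<alpha> * (1 - \<rho>) = k * \<rho>"
        using eigen_Up by (simp add: k_def algebra_simps)
      then have eU: "z ^ n * (lam * (z - 1) * \<rho>) + z ^ n * (\<alpha> * (1 - \<rho>)) = z ^ n * (k * \<rho>)"
        by (simp flip: distrib_left)
      have eD: "z ^ n * (lam * (z - 1)) + z ^ n * (\<beta> * (\<rho> - 1)) = 0"
        using eigen_Down by (simp flip: distrib_left)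
      show ?thesis
      proof (cases s)
        case Up
        then show ?thesis
          using eU t2 True unfolding d t1 t3 by (auto simp: u_def n_def mult_ac)
      next
        case Down
        then show ?thesis
          using eD True unfolding d t1 t3 by (auto simp: u_def n_def)
      qed
    next
      case False
      then have "F n s = 0" "F (n + 1) s = 0" for s by (simp_all add: F_def)
      moreover have "F (n - 1) Up = 0"
        using False by (cases "n = N + 1") (auto simp: F_def u_def)
      ultimately have "drift f (x, y, s) = 0" unfolding d by simp
      then show ?thesis using False by (auto simp: n_def)
    qed
  qed
  let ?E = "\<lambda>\<phi> e t. if t \<in> \<phi> ` {..N} then pmf \<pi> t * (e t :: real) else 0"
  have "((\<lambda>t. ?E (\<lambda>y. (0, y, Up)) (\<lambda>t. k * \<rho> * z ^ fst (snd t)) t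
      - (?E (\<lambda>y. (N - y, y, Up)) (\<lambda>t. z ^ N * u Up * c Up) t
         + ?E (\<lambda>y. (N - y, y, Down)) (\<lambda>t. z ^ N * u Down * c Down) t)) has_sum
     ((\<Sum>y\<le>N. pmf \<pi> (0, y, Up) * (k * \<rho> * z ^ fst (snd (0 :: nat, y, Up))))
      - ((\<Sum>y\<le>N. pmf \<pi> (N - y, y, Up) * (z ^ N * u Up * c Up))
         + (\<Sum>y\<le>N. pmf \<pi> (N - y, y, Down) * (z ^ N * u Down * c Down))))) UNIV"
    (is "(?g has_sum ?S) UNIV")
    by (intro has_sum_diff_real has_sum_add has_sum_if_image) (auto simp: inj_on_def)
  moreover have "?g t = pmf \<pi> t * drift f t" for t
  proof (cases t)
    case (fields x y s)
    have m: "(x, y, s) \<in> (\<lambda>y. (0, y, Up)) ` {..N} \<longleftrightarrow> x = 0 \<and> s = Up \<and> y \<le> N"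
      "(x, y, s) \<in> (\<lambda>y. (N - y, y, s')) ` {..N} \<longleftrightarrow> x + y = N \<and> s = s'" for s'
      by (auto simp: image_iff)
    show ?thesis unfolding fields df m
      by (cases s) (auto simp: right_diff_distrib)
  qed
  ultimately have "((\<lambda>t. pmf \<pi> t * drift f t) has_sum ?S) UNIV" by simp
  from has_sum_unique[OF this expected_drift[OF bd]] have "?S = 0" .
  moreover have "(\<Sum>y\<le>N. pmf \<pi> (0, y, Up) * (k * \<rho> * z ^ fst (snd (0 :: nat, y, Up)))) = k * (\<Sum>y\<le>N. A 0 y Up)"
    by (simp add: A_def u_def sum_distrib_left mult_ac)
  moreover have "(\<Sum>y\<le>N. pmf \<pi> (N - y, y, s) * (z ^ N * u s * c s)) = (\<Sum>y\<le>N. c s * A (N - y) y s)" for s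
    by (intro sum.cong) (simp_all add: A_def)
  ultimately show ?thesis
    by (simp add: sum.distrib k_def[symmetric])
qed

lemma A_boundary_summable: "summable (\<lambda>y. A 0 y Up)"
proof -
  obtain w where w: "z < w" "lam * w < \<mu> * p" "p + (1 - p) * w < z"
    using exists_w by blast
  have "norm (A 0 y Up) \<le> pmf \<pi> (0, y, Up) * w ^ y" for y
  proof -
    have "z ^ y * u Up \<le> w ^ y * 1"
      using z w u_bounds[of Up] by (intro mult_mono power_mono) auto
    then show ?thesis
      using z u_bounds[of Up] by (simp add: A_def mult.assoc mult_left_mono)
  qed
  then show ?thesis
    by (intro summable_comparison_test[OF _ boundary_summable[OF w]]) blast
qed

definition F :: real where "F = \<mu> * p * (1 - 1 / z) * (\<Sum>y. A 0 y Up)"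

lemma level_lim: "(\<lambda>N. \<Sum>y\<le>N. c Up * A (N - y) y Up + c Down * A (N - y) y Down) \<longlonglongrightarrow> F"
  unfolding level_identity F_def
  by (intro tendsto_intros summable_LIMSEQ' A_boundary_summable)

lemma k_pos: "\<mu> * p * (1 - 1 / z) > 0"
  using pos z by (simp add: field_simps)

text \<open>By \<open>level_identity\<close> the level sums are multiples of partial sums of a
  nonnegative series with total \<open>F\<close>, and a single term is at most its level
  sum.\<close>

lemma level_sum_le: "c s * A x y s \<le> F"
proof -
  let ?g = "\<lambda>N y. c Up * A (N - y) y Up + c Down * A (N - y) y Down"
  have nn: "0 \<le> c s * A x y s" for x y s
    using c_pos[of s] A_nonneg[of x y s] by simp
  have "c s * A x y s \<le> ?g (x + y) y"
    using nn[of Up x y] nn[of Down x y] by (cases s) auto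
  also have "\<dots> \<le> (\<Sum>j\<le>x + y. ?g (x + y) j)"
    using nn by (intro member_le_sum[of y _ "?g (x + y)"] add_nonneg_nonneg) auto
  also have "\<dots> \<le> F"
    unfolding level_identity F_def
    using k_pos A_nonneg by (intro mult_left_mono sum_le_suminf A_boundary_summable) auto
  finally show ?thesis .
qed

text \<open>Otherwise \<open>level_sum_le\<close> would force every mass of \<pi> to be 0.\<close>

lemma F_pos: "F > 0"
proof (rule ccontr)
  assume F: "\<not> F > 0"
  have "pmf \<pi> (x, y, s) = 0" for x y s
  proof -
    have "c s * A x y s \<le> 0" using level_sum_le[of s x y] F by linarith
    then have "A x y s = 0" using c_pos[of s] A_nonneg[of x y s] by (simp add: mult_le_0_iff)
    then show ?thesis using u_bounds[of s] z by (simp add: A_def)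
  qed
  moreover obtain t where "t \<in> set_pmf \<pi>" using set_pmf_not_empty[of \<pi>] by auto
  ultimately show False by (cases t) (simp add: set_pmf_iff)
qed

lemma A_bounded: "\<exists>T>0. \<forall>x y s. A x y s \<le> T"
proof (intro exI conjI allI)
  show "F / c Up + F / c Down > 0"
    using F_pos c_pos by (simp add: add_pos_pos)
  fix x y s
  have "A x y s \<le> F / c s"
    using level_sum_le[of s x y] c_pos[of s] by (simp add: field_simps)
  moreover have "F / c s' > 0" for s' using F_pos c_pos by simp
  from this[of Up] this[of Down] have "F / c s \<le> F / c Up + F / c Down" by (cases s) auto
  ultimately show "A x y s \<le> F / c Up + F / c Down" by linarith
qed

text \<open>The weight \<open>z\<^sup>x w\<^sup>y u\<close> has negative drift away from the two boundaries. The cutoff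
  \<open>\<theta> ^ \<bar>x + y - N\<bar>\<close> localizes it near the level \<open>N\<close>, so that the boundary terms stay
  summable uniformly in \<open>N\<close>.\<close>

lemma A_geometric: "\<exists>C r. 0 < r \<and> r < 1 \<and> (\<forall>x y s. A x y s \<le> C * r ^ y)"
proof -
  obtain w where w: "z < w" "lam * w < \<mu> * p" "p + (1 - p) * w < z"
    and e0: "\<mu> / w - lam - \<mu> * (1 - p) / z > 0"
    using exists_w by blast
  have w1: "w > 1" using w z by simp
  \<comment> \<open>\<epsilon> is the decay rate of the weight \<open>H\<close> away from the
    boundaries, positive by the choice of \<open>w\<close>.\<close>
  define \<epsilon> where "\<epsilon> = (w - z) * (\<mu> / w - lam - \<mu> * (1 - p) / z)"
  have eps: "\<epsilon> > 0" using e0 w by (simp add: \<epsilon>_def)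
  \<comment> \<open>Only arrivals and departures change x + y; \<open>k\<close> bounds their
    contribution relative to \<open>H\<close>. With this \<open>e\<close>, a cutoff varying by a
    factor of at most 1 + e per level costs no more than half of \<epsilon>.\<close>
  define k where "k = lam * w + \<mu> * p / z"
  have k: "k > 0" using pos z w1 by (simp add: k_def add_pos_pos)
  define e where "e = \<epsilon> / (2 * k)"
  have e: "e > 0" "e * k = \<epsilon> / 2" using eps k by (simp_all add: e_def)
  define \<theta> where "\<theta> = 1 / (1 + e)"
  have theta: "0 < \<theta>" "\<theta> < 1" "(1 + e) * \<theta> = 1" using e by (simp_all add: \<theta>_def)
  define H where "H = (\<lambda>(x, y, s). z ^ x * w ^ y * u s)"
  have H_nonneg: "H t \<ge> 0" for t
    using z w1 u_bounds by (cases t) (simp add: H_def less_imp_le)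
  obtain T where T: "T > 0" "\<And>x y s. A x y s \<le> T" using A_bounded by blast
  define W where "W = (\<Sum>y. pmf \<pi> (0, y, Up) * w ^ y)"
  \<comment> \<open>Total boundary contribution: for y = 0 there are two statuses, each bounded by
    \<open>T\<close> times the two-sided geometric sum; for x = 0 in status Up it is bounded by
    \<open>W\<close>.\<close>
  define K where "K = \<mu> * (2 * (T * (2 / (1 - \<theta>))) + W)"
  have dH: "drift H (x, y, s)
      \<le> (- \<epsilon> + (if y = 0 then \<mu> else 0) + (if x = 0 \<and> s = Up then \<mu> else 0)) * H (x, y, s)"
    for x y s
  proof -
    define B where "B = lam * (w - 1) * u s + (if y = 0 then 0 else \<mu> * (z / w - 1) * u s)
     + (if x = 0 \<or> s = Down then 0 else (\<mu> * p * (1 / z - 1) + \<mu> * (1 - p) * (w / z - 1)) * u Up)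
     + (if s = Up then \<alpha> * (u Down - u Up) else \<beta> * (u Up - u Down))"
    have dB: "drift H (x, y, s) = z ^ x * w ^ y * B"
      unfolding H_def B_def using z w1 by (subst drift_monomial) auto
    have eq: "\<mu> * (z / w - 1) = - ((w - z) * (\<mu> / w))"
      "\<mu> * (1 - p) * (w / z - 1) = (w - z) * (\<mu> * (1 - p) / z)"
      using z w1 by (simp_all add: field_simps)
    have p1: "\<mu> * (1 - p) / z \<ge> 0" using pos z by simp
    have b1: "- (\<mu> * (z / w - 1) * u s) \<le> \<mu> * u s"
    proof -
      have "\<mu> * (z / w) * u s \<ge> 0" using pos z w1 u_bounds[of s] by simp
      then show ?thesis by (simp add: algebra_simps)
    qed
    have b2: "- ((\<mu> * p * (1 / z - 1) + \<mu> * (1 - p) * (w / z - 1)) * u Up) \<le> \<mu> * u Up"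
    proof -
      have "\<mu> * p * (1 / z) + \<mu> * (1 - p) * (w / z) \<ge> 0" using pos z w1 by simp
      then have "- (\<mu> * p * (1 / z - 1) + \<mu> * (1 - p) * (w / z - 1)) \<le> \<mu>"
        by (simp add: algebra_simps)
      from mult_right_mono[OF this, of "u Up"] show ?thesis
        using u_bounds(1)[of Up] unfolding mult_minus_left by linarith
    qed
    \<comment> \<open>The factor away from both boundaries. Replacing \<open>z ^ y\<close> by
      \<open>w ^ y\<close> in the harmonic weight shifts the eigenvector equation by exactly -
      \<epsilon> u(s) for Up, and by even less for Down, where the positive feedback term is
      absent.\<close>
    have full: "(if s = Up
        then lam * (w - 1) * \<rho> + \<mu> * (z / w - 1) * \<rho>
          + (\<mu> * p * (1 / z - 1) + \<mu> * (1 - p) * (w / z - 1)) * \<rho> + \<alpha> * (1 - \<rho>)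
        else lam * (w - 1) + \<mu> * (z / w - 1) + \<beta> * (\<rho> - 1)) \<le> - \<epsilon> * u s"
    proof (cases s)
      case Up
      have "lam * (w - 1) * \<rho> + \<mu> * (z / w - 1) * \<rho>
          + (\<mu> * p * (1 / z - 1) + \<mu> * (1 - p) * (w / z - 1)) * \<rho> + \<alpha> * (1 - \<rho>)
        = (lam * (z - 1) * \<rho> + \<mu> * p * (1 / z - 1) * \<rho> + \<alpha> * (1 - \<rho>)) - \<epsilon> * \<rho>"
      proof -
        have "lam * (w - 1) * \<rho> + - ((w - z) * d1) * \<rho> + (d3 + (w - z) * d2) * \<rho> + \<alpha> * (1 - \<rho>)
          = (lam * (z - 1) * \<rho> + d3 * \<rho> + \<alpha> * (1 - \<rho>)) - (w - z) * (d1 - lam - d2) * \<rho>" for d1 d2 d3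
          by (simp add: algebra_simps)
        then show ?thesis unfolding eq \<epsilon>_def .
      qed
      then show ?thesis using Up eigen_Up by (simp add: u_def)
    next
      case Down
      have "lam * (w - 1) + \<mu> * (z / w - 1) + \<beta> * (\<rho> - 1)
        = (lam * (z - 1) + \<beta> * (\<rho> - 1)) - (\<epsilon> + (w - z) * (\<mu> * (1 - p) / z))"
      proof -
        have "lam * (w - 1) + - ((w - z) * d1) + \<beta> * (\<rho> - 1)
          = (lam * (z - 1) + \<beta> * (\<rho> - 1)) - ((w - z) * (d1 - lam - d2) + (w - z) * d2)" for d1 d2
          by (simp add: algebra_simps)
        then show ?thesis unfolding eq \<epsilon>_def .
      qed
      moreover have "(w - z) * (\<mu> * (1 - p) / z) \<ge> 0" using p1 w by (intro mult_nonneg_nonneg) auto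
      ultimately show ?thesis using Down eigen_Down by (simp add: u_def)
    qed
    have "B \<le> - \<epsilon> * u s + (if y = 0 then \<mu> * u s else 0) + (if x = 0 \<and> s = Up then \<mu> * u s else 0)"
    proof (cases s)
      case Up
      then show ?thesis using full b1 b2
        by (cases "x = 0"; cases "y = 0") (simp_all add: B_def u_def)
    next
      case Down
      then show ?thesis using full b1
        by (cases "x = 0"; cases "y = 0") (simp_all add: B_def u_def)
    qed
    then have "B \<le> (- \<epsilon> + (if y = 0 then \<mu> else 0) + (if x = 0 \<and> s = Up then \<mu> else 0)) * u s"
      by (auto simp: algebra_simps split: if_splits)
    from mult_left_mono[OF this, of "z ^ x * w ^ y"] show ?thesis
      unfolding dB using z w1 by (simp add: H_def mult_ac)
  qed
  have main: "A x y s \<le> (2 * K / \<epsilon>) * (z / w) ^ y" for x y s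
  proof -
    define N where "N = x + y"
    define cut where "cut n = \<theta> ^ ((n - N) + (N - n))" for n
    have chi: "0 < cut n" "cut n \<le> 1" for n
      using theta by (auto simp: cut_def intro: power_le_one)
    have chi_step: "cut m \<le> (1 + e) * cut n" if "m = n + 1 \<or> n = m + 1" for m n
    proof -
      have "\<theta> * cut m = \<theta> ^ ((m - N) + (N - m) + 1)" by (simp add: cut_def)
      also have "\<dots> \<le> cut n" unfolding cut_def using that theta by (intro power_decreasing) auto
      finally have "(1 + e) * (\<theta> * cut m) \<le> (1 + e) * cut n" using e by (intro mult_left_mono) auto
      then show ?thesis using theta(3) by (simp flip: mult.assoc)
    qed
    define f where "f = (\<lambda>(x, y, s). cut (x + y) * H (x, y, s))"
    define b where "b = (\<lambda>(x, y, s).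
        ((if y = 0 then \<mu> else 0) + (if x = 0 \<and> s = Up then \<mu> else 0)) * f (x, y, s))"
    have f_nonneg: "f t \<ge> 0" for t
      using chi(1) H_nonneg by (cases t) (simp add: f_def less_imp_le)
    have df: "drift f (x, y, s) \<le> b (x, y, s) - \<epsilon> / 2 * f (x, y, s)" for x y s
    proof -
      have h1: "H (x, y + 1, s) = w * H (x, y, s)" by (simp add: H_def)
      have h2: "H (x - 1, y, Up) = H (x, y, Up) / z" if "x \<noteq> 0"
        using that z by (cases x) (auto simp: H_def)
      have a1: "f (x, y + 1, s) \<le> (1 + e) * cut (x + y) * H (x, y + 1, s)"
        using mult_right_mono[OF chi_step[of "x + y + 1" "x + y"] H_nonneg] by (simp add: f_def)
      have a2: "f (x + 1, y - 1, s) = cut (x + y) * H (x + 1, y - 1, s)" if "y \<noteq> 0"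
        using that by (simp add: f_def)
      have a3: "f (x - 1, y, Up) \<le> (1 + e) * cut (x + y) * H (x - 1, y, Up)" if "x \<noteq> 0"
        using mult_right_mono[OF chi_step[of "x - 1 + y" "x + y"] H_nonneg] that by (simp add: f_def)
      have a4: "f (x - 1, y + 1, Up) = cut (x + y) * H (x - 1, y + 1, Up)" if "x \<noteq> 0"
        using that by (simp add: f_def)
      have a5: "f (x, y, s') = cut (x + y) * H (x, y, s')" for s'
        by (simp add: f_def)
      \<comment> \<open>With the arrival term, this is the only contribution in which the cutoff is
        evaluated at another level; only these two pick up the factor 1 + e.\<close>
      define R where "R = (if x = 0 \<or> s = Down then 0 else \<mu> * p * H (x - 1, y, Up))"
      have "act f (x, y, s) \<le> cut (x + y) * (act H (x, y, s) + e * (lam * H (x, y + 1, s) + R))"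
      proof -
        have l1: "lam * f (x, y + 1, s) \<le> lam * ((1 + e) * cut (x + y) * H (x, y + 1, s))"
          using a1 pos by (intro mult_left_mono) auto
        have l2: "\<mu> * p * f (x - 1, y, Up) \<le> \<mu> * p * ((1 + e) * cut (x + y) * H (x - 1, y, Up))" if "x \<noteq> 0"
          using a3[OF that] pos by (intro mult_left_mono) auto
        have "act f (x, y, s) \<le> lam * ((1 + e) * cut (x + y) * H (x, y + 1, s))
           + (if y = 0 then 0 else \<mu> * (cut (x + y) * H (x + 1, y - 1, s)))
           + (if x = 0 \<or> s = Down then 0 else \<mu> * p * ((1 + e) * cut (x + y) * H (x - 1, y, Up))
              + \<mu> * (1 - p) * (cut (x + y) * H (x - 1, y + 1, Up)))
           + (if s = Up then \<alpha> * (cut (x + y) * H (x, y, Down)) else \<beta> * (cut (x + y) * H (x, y, Up)))"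
          unfolding act.simps using l1 l2 a2 a4 a5 by (intro add_mono) auto
        also have "\<dots> = cut (x + y) * (act H (x, y, s) + e * (lam * H (x, y + 1, s) + R))"
          unfolding act.simps R_def by (simp add: algebra_simps)
        finally show ?thesis .
      qed
      also have "R \<le> \<mu> * p / z * H (x, y, s)"
        using H_nonneg[of "(x, y, s)"] h2 pos z by (cases s) (auto simp: R_def)
      then have "lam * H (x, y + 1, s) + R \<le> k * H (x, y, s)"
        unfolding h1 k_def distrib_right by (simp add: mult.assoc)
      then have "cut (x + y) * (act H (x, y, s) + e * (lam * H (x, y + 1, s) + R))
          \<le> cut (x + y) * (act H (x, y, s) + e * (k * H (x, y, s)))"
        using chi(1)[of "x + y"] e by (intro mult_left_mono add_left_mono) auto
      finally have "drift f (x, y, s) \<le> cut (x + y) * (drift H (x, y, s) + e * k * H (x, y, s))"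
        unfolding drift_def a5 by (simp add: algebra_simps)
      also have "\<dots> \<le> cut (x + y) * ((- \<epsilon> + (if y = 0 then \<mu> else 0)
          + (if x = 0 \<and> s = Up then \<mu> else 0)) * H (x, y, s) + \<epsilon> / 2 * H (x, y, s))"
        unfolding e(2) using dH[of x y s] chi(1)[of "x + y"] by (intro mult_left_mono add_right_mono) auto
      also have "\<dots> = b (x, y, s) - \<epsilon> / 2 * f (x, y, s)"
        unfolding b_def prod.case a5 by (simp add: algebra_simps)
      finally show ?thesis .
    qed
    \<comment> \<open>A single state suffices: by N = x + y the cutoff equals 1 there, and
      \<open>K\<close> depends neither on N nor on the state.\<close>
    have "(\<Sum>t\<in>{(x, y, s)}. pmf \<pi> t * (\<epsilon> / 2 * f t)) \<le> K"
    proof (rule lyapunov[where f = f and b = b])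
      show "b t \<ge> 0" for t
        using f_nonneg[of t] pos by (cases t) (simp add: b_def)
      show "\<epsilon> / 2 * f t \<ge> 0" for t using f_nonneg[of t] eps by simp
      show "drift f t \<le> b t - \<epsilon> / 2 * f t" for t using df by (cases t) auto
      fix S :: "state set" assume S: "finite S"
      \<comment> \<open>\<open>S\<close> is enclosed in a box, over which the row y = 0 and the
        column x = 0 can be summed separately.\<close>
      define n where "n = (\<Sum>t\<in>S. fst t + fst (snd t))"
      have "S \<subseteq> {..n} \<times> {..n} \<times> {Up, Down}"
      proof
        fix t assume t: "t \<in> S"
        obtain x y s where xys: "t = (x, y, s)" by (cases t)
        have "fst t + fst (snd t) \<le> n" unfolding n_def using t S by (intro member_le_sum) auto
        then show "t \<in> {..n} \<times> {..n} \<times> {Up, Down}" unfolding xys by (cases s) auto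
      qed
      then have "(\<Sum>t\<in>S. pmf \<pi> t * b t) \<le> (\<Sum>t\<in>{..n} \<times> {..n} \<times> {Up, Down}. pmf \<pi> t * b t)"
        using f_nonneg pos by (intro sum_mono2) (auto simp: b_def)
      also have "\<dots> \<le> (\<Sum>t\<in>{..n} \<times> {..n} \<times> {Up, Down}. \<mu> * (case t of (x, y, s) \<Rightarrow>
          (if y = 0 then T * cut x else 0) + (if x = 0 \<and> s = Up then pmf \<pi> (0, y, Up) * w ^ y else 0)))"
      proof (rule sum_mono)
        fix t :: state
        show "pmf \<pi> t * b t \<le> \<mu> * (case t of (x, y, s) \<Rightarrow>
          (if y = 0 then T * cut x else 0) + (if x = 0 \<and> s = Up then pmf \<pi> (0, y, Up) * w ^ y else 0))"
        proof (cases t)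
          case (fields x y s)
          have 1: "pmf \<pi> (x, y, s) * f (x, y, s) \<le> T * cut x" if "y = 0"
          proof -
            have "pmf \<pi> (x, y, s) * f (x, y, s) = A x y s * cut x"
              using that by (simp add: f_def H_def A_def)
            also have "\<dots> \<le> T * cut x" using T(2) chi(1)[of x] by (intro mult_right_mono) auto
            finally show ?thesis .
          qed
          have 2: "pmf \<pi> (x, y, s) * f (x, y, s) \<le> pmf \<pi> (0, y, Up) * w ^ y" if "x = 0 \<and> s = Up"
          proof -
            have "cut y * (w ^ y * u Up) \<le> 1 * (w ^ y * 1)"
              using chi[of y] w1 u_bounds[of Up] by (intro mult_mono) auto
            then have "pmf \<pi> (0, y, Up) * (cut y * (w ^ y * u Up)) \<le> pmf \<pi> (0, y, Up) * w ^ y"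
              by (intro mult_left_mono) auto
            then show ?thesis using that by (simp add: f_def H_def)
          qed
          have "pmf \<pi> t * b t = \<mu> * ((if y = 0 then pmf \<pi> (x, y, s) * f (x, y, s) else 0)
              + (if x = 0 \<and> s = Up then pmf \<pi> (x, y, s) * f (x, y, s) else 0))"
            by (simp add: fields b_def algebra_simps)
          also have "\<dots> \<le> \<mu> * ((if y = 0 then T * cut x else 0)
              + (if x = 0 \<and> s = Up then pmf \<pi> (0, y, Up) * w ^ y else 0))"
            using 1 2 pos by (intro mult_left_mono add_mono) auto
          finally show ?thesis by (simp add: fields)
        qed
      qed
      also have "\<dots> = \<mu> * (\<Sum>x\<le>n. \<Sum>y\<le>n. \<Sum>s\<in>{Up, Down}.
          (if y = 0 then T * cut x else 0) + (if x = 0 \<and> s = Up then pmf \<pi> (0, y, Up) * w ^ y else 0))"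
        by (simp only: sum_distrib_left[symmetric] sum.cartesian_product)
      also have "(\<Sum>x\<le>n. \<Sum>y\<le>n. \<Sum>s\<in>{Up, Down}.
          (if y = 0 then T * cut x else 0) + (if x = 0 \<and> s = Up then pmf \<pi> (0, y, Up) * w ^ y else 0))
        = (\<Sum>x\<le>n. \<Sum>y\<le>n. (if y = 0 then 2 * (T * cut x) else 0))
          + (\<Sum>x\<le>n. \<Sum>y\<le>n. (if x = 0 then pmf \<pi> (0, y, Up) * w ^ y else 0))"
        unfolding sum.distrib[symmetric] by (intro sum.cong) auto
      also have "(\<Sum>x\<le>n. \<Sum>y\<le>n. (if y = 0 then 2 * (T * cut x) else 0)) = 2 * (T * (\<Sum>x\<le>n. cut x))"
        by (simp add: sum.delta sum_distrib_left)
      also have "(\<Sum>x\<le>n. \<Sum>y\<le>n. (if x = 0 then pmf \<pi> (0, y, Up) * w ^ y else 0)) = (\<Sum>y\<le>n. pmf \<pi> (0, y, Up) * w ^ y)"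
        by (subst sum.swap) (simp add: sum.delta)
      also have "\<mu> * (2 * (T * (\<Sum>x\<le>n. cut x)) + (\<Sum>y\<le>n. pmf \<pi> (0, y, Up) * w ^ y)) \<le> K"
        unfolding K_def
      proof (intro mult_left_mono add_mono)
        show "(\<Sum>x\<le>n. cut x) \<le> 2 / (1 - \<theta>)"
          unfolding cut_def by (rule sum_two_sided_geometric) (use theta in auto)
        show "(\<Sum>y\<le>n. pmf \<pi> (0, y, Up) * w ^ y) \<le> W"
          unfolding W_def using w1 by (intro sum_le_suminf boundary_summable w) auto
      qed (use T pos in auto)
      finally show "(\<Sum>t\<in>S. pmf \<pi> t * b t) \<le> K" .
    qed (use f_nonneg in auto)
    then have "pmf \<pi> (x, y, s) * (z ^ x * w ^ y * u s) \<le> 2 * K / \<epsilon>"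
      using eps by (simp add: f_def H_def cut_def N_def field_simps)
    then have "pmf \<pi> (x, y, s) * (z ^ x * w ^ y * u s) * (z / w) ^ y \<le> 2 * K / \<epsilon> * (z / w) ^ y"
      using z w1 by (intro mult_right_mono) auto
    moreover have "pmf \<pi> (x, y, s) * (z ^ x * w ^ y * u s) * (z / w) ^ y = A x y s"
      using w1 by (simp add: A_def power_add power_divide)
    ultimately show ?thesis by simp
  qed
  have "0 < z / w" "z / w < 1" using w z by (auto simp: field_simps)
  with main show ?thesis by blast
qed

end

section \<open>Asymptotics\<close>

context network_decay
begin

text \<open>Doob transform: for the harmonic h, the measure h \<pi> is balanced for the rates
  multiplied by h(target) / h(source). As h is harmonic at states with x \<ge> 1, the exit rates
  there are unchanged, which makes the transformed walk conservative.\<close>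

lemma A_balance:
  assumes "x \<ge> 1"
  shows "walk.defect (lam * z) \<mu> (\<mu> * p / z) (\<mu> * (1 - p)) (\<alpha> / \<rho>) (\<beta> * \<rho>) (\<lambda>i. A (nat i)) (int x) y s = 0"
proof -
  interpret walk "lam * z" \<mu> "\<mu> * p / z" "\<mu> * (1 - p)" "\<alpha> / \<rho>" "\<beta> * \<rho>"
    by unfold_locales (use pos z rho_bounds in auto)
  define Z where "Z = z ^ (x + y)"
  have nat: "nat (int x - 1) = x - 1" "nat (int x + 1) = x + 1" "nat (int x) = x"
    using assms by auto
  have t1: "lam * z * A x (y - 1) s = Z * u s * (lam * pmf \<pi> (x, y - 1, s))" if "y \<noteq> 0"
    using that by (cases y) (auto simp: A_def Z_def)
  have t2: "\<mu> * A (x - 1) (y + 1) s = Z * u s * (\<mu> * pmf \<pi> (x - 1, y + 1, s))"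
    using assms by (cases x) (auto simp: A_def Z_def)
  have t3: "\<mu> * p / z * A (x + 1) y Up = Z * u Up * (\<mu> * p * pmf \<pi> (x + 1, y, Up))"
    using z by (simp add: A_def Z_def)
  have t4: "\<mu> * (1 - p) * A (x + 1) (y - 1) Up = Z * u Up * (\<mu> * (1 - p) * pmf \<pi> (x + 1, y - 1, Up))" if "y \<noteq> 0"
    using that by (cases y) (auto simp: A_def Z_def)
  have t5: "\<beta> * \<rho> * A x y Down = Z * u Up * (\<beta> * pmf \<pi> (x, y, Down))"
    by (simp add: A_def Z_def u_def)
  have t6: "\<alpha> / \<rho> * A x y Up = Z * u Down * (\<alpha> * pmf \<pi> (x, y, Up))"
    using rho_bounds by (simp add: A_def Z_def u_def)
  have inflow: "inflow (\<lambda>i. A (nat i)) (int x) y s = Z * u s *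
     ((if y = 0 then 0 else lam * pmf \<pi> (x, y - 1, s)) + (if x = 0 then 0 else \<mu> * pmf \<pi> (x - 1, y + 1, s))
      + (if s = Up then \<mu> * p * pmf \<pi> (x + 1, y, Up)
           + (if y = 0 then 0 else \<mu> * (1 - p) * pmf \<pi> (x + 1, y - 1, Up)) + \<beta> * pmf \<pi> (x, y, Down)
         else \<alpha> * pmf \<pi> (x, y, Up)))"
  proof -
    have "inflow (\<lambda>i. A (nat i)) (int x) y s =
      (if y = 0 then 0 else Z * u s * (lam * pmf \<pi> (x, y - 1, s))) + Z * u s * (\<mu> * pmf \<pi> (x - 1, y + 1, s))
      + (if s = Up then Z * u Up * (\<mu> * p * pmf \<pi> (x + 1, y, Up))
           + (if y = 0 then 0 else Z * u Up * (\<mu> * (1 - p) * pmf \<pi> (x + 1, y - 1, Up)))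
           + Z * u Up * (\<beta> * pmf \<pi> (x, y, Down))
         else Z * u Down * (\<alpha> * pmf \<pi> (x, y, Up)))"
      unfolding inflow_def nat by (simp only: t1 t2 t3 t4 t5 t6 not_False_eq_True cong: if_cong)
    then show ?thesis
      using assms by (cases s) (simp_all add: distrib_left)
  qed
  have "outrate y s = act (\<lambda>_. 1) (x, y, s)"
  proof (cases s)
    case Up
    have "\<rho> * (lam * (z - 1) + \<mu> * p * (1 / z - 1) + \<alpha> * (1 / \<rho> - 1)) = 0"
      using eigen_Up rho_bounds by (simp add: algebra_simps)
    then have "lam * (z - 1) + \<mu> * p * (1 / z - 1) + \<alpha> * (1 / \<rho> - 1) = 0"
      using rho_bounds by simp
    then show ?thesis
      unfolding outrate_def using assms Up by (simp add: algebra_simps)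
  next
    case Down
    then show ?thesis
      unfolding outrate_def using assms eigen_Down by (simp add: algebra_simps)
  qed
  then show ?thesis
    unfolding defect_def inflow global_balance nat by (simp add: A_def Z_def)
qed

theorem A_converges: "\<exists>L. \<forall>y s. L y s > 0 \<and> (\<lambda>k. A k y s) \<longlonglongrightarrow> L y s"
proof -
  obtain C r where "0 < r" "r < 1" "\<And>x y s. A x y s \<le> C * r ^ y"
    using A_geometric by blast
  then interpret stationary_walk "lam * z" \<mu> "\<mu> * p / z" "\<mu> * (1 - p)" "\<alpha> / \<rho>" "\<beta> * \<rho>" C r c A F
    using pos z rho_bounds c_pos A_nonneg A_balance level_lim F_pos
    by unfold_locales auto
  show ?thesis by (rule convergent_to_positive)
qed

lemma pmf_asymp_equiv: "\<exists>C>0. (\<lambda>k. pmf \<pi> (k, y, s)) \<sim>[sequentially] (\<lambda>k. C * (1 / z) ^ k)"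
proof -
  obtain L where L: "L > 0" "(\<lambda>k. A k y s) \<longlonglongrightarrow> L"
    using A_converges by blast
  define C where "C = L / (z ^ y * u s)"
  have "C > 0" using L z u_bounds[of s] by (simp add: C_def)
  have "(\<lambda>k. A k y s / L) \<longlonglongrightarrow> L / L"
    using L by (intro tendsto_intros) auto
  moreover have "A k y s / L = pmf \<pi> (k, y, s) / (C * (1 / z) ^ k)" for k
    using L z u_bounds[of s] by (simp add: A_def C_def power_add power_divide)
  ultimately have "(\<lambda>k. pmf \<pi> (k, y, s) / (C * (1 / z) ^ k)) \<longlonglongrightarrow> 1"
    using L by simp
  then have "(\<lambda>k. pmf \<pi> (k, y, s)) \<sim>[sequentially] (\<lambda>k. C * (1 / z) ^ k)"
    by (rule asymp_equivI')
  with \<open>C > 0\<close> show ?thesis by blast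
qed

end

text \<open>\<open>1 / \<gamma>\<^sub>p\<close> is the smaller root of \<open>(\<mu> p - lam t) (lam + \<beta> - lam t) = \<alpha> lam t\<close>.\<close>

lemma gamma_p_root:
  fixes lam \<mu> \<alpha> \<beta> p :: real
  assumes pos: "lam > 0" "\<mu> > 0" "\<alpha> > 0" "\<beta> > 0" "0 < p"
    and stable: "lam < \<beta> / (\<alpha> + \<beta>) * \<mu> * p"
  defines "z \<equiv> 1 / gamma_p lam \<mu> \<alpha> \<beta> p"
  shows "1 < z" "lam * z < \<mu> * p" "lam * z < lam + \<beta>"
    "(\<mu> * p - lam * z) * (lam + \<beta> - lam * z) = \<alpha> * lam * z"
proof -
  define m where "m = \<mu> * p"
  define S where "S = lam + \<beta> + m + \<alpha>"
  define R where "R = sqrt (s_p lam \<mu> \<alpha> \<beta> p)"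
  have m: "m > 0" using pos by (simp add: m_def)
  have s: "s_p lam \<mu> \<alpha> \<beta> p = S\<^sup>2 - 4 * m * (lam + \<beta>)"
    by (simp add: s_p_def S_def m_def power2_eq_square algebra_simps)
  \<comment> \<open>Two ways to complete the square; they bound \<open>R\<close> from below and
    yield \<open>lam * z < \<mu> * p\<close> and \<open>lam * z < lam + \<beta>\<close>.\<close>
  have s1: "s_p lam \<mu> \<alpha> \<beta> p = (\<beta> + lam + \<alpha> - m)\<^sup>2 + 4 * \<alpha> * m"
    and s2: "s_p lam \<mu> \<alpha> \<beta> p = (m + \<alpha> - lam - \<beta>)\<^sup>2 + 4 * \<alpha> * (lam + \<beta>)"
    by (simp_all add: s_p_def m_def power2_eq_square algebra_simps)
  have "s_p lam \<mu> \<alpha> \<beta> p \<ge> 0" unfolding s1 using m pos by simp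
  then have R2: "R\<^sup>2 = S\<^sup>2 - 4 * m * (lam + \<beta>)"
    unfolding R_def s[symmetric] by simp
  have lz: "lam * z = (S - R) / 2"
    using pos by (simp add: z_def gamma_p_def S_def R_def m_def)
  have st: "lam * (\<alpha> + \<beta>) < m * \<beta>"
    using stable pos by (simp add: m_def field_simps)
  \<comment> \<open>Equivalent to 1 < z; after squaring it is exactly the stability condition
    \<open>st\<close>.\<close>
  have "R < S - 2 * lam"
    unfolding R_def
  proof (rule real_less_lsqrt)
    have "\<beta> * lam < \<beta> * m" using st pos by (smt (verit) mult.commute mult_pos_pos distrib_left)
    then have "lam < m" using pos by simp
    then show "0 \<le> S - 2 * lam" using pos by (simp add: S_def)
    show "s_p lam \<mu> \<alpha> \<beta> p < (S - 2 * lam)\<^sup>2"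
      using st unfolding s by (simp add: S_def power2_eq_square algebra_simps)
  qed
  then have "lam < lam * z" using lz by simp
  then show "1 < z" using pos by simp
  have "\<beta> + lam + \<alpha> - m < R"
    unfolding R_def s1 using pos m by (intro real_less_rsqrt) simp
  then show "lam * z < \<mu> * p" unfolding lz by (simp add: S_def m_def)
  have "m + \<alpha> - lam - \<beta> < R"
    unfolding R_def s2 using pos by (intro real_less_rsqrt) simp
  then show "lam * z < lam + \<beta>" unfolding lz by (simp add: S_def)
  have "(m - lam * z) * (lam + \<beta> - lam * z) - \<alpha> * (lam * z) = (lam * z)\<^sup>2 - S * (lam * z) + m * (lam + \<beta>)"
    by (simp add: S_def power2_eq_square algebra_simps)
  also have "\<dots> = (R\<^sup>2 - S\<^sup>2) / 4 + m * (lam + \<beta>)"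
    unfolding lz by (simp add: power2_eq_square field_simps)
  also have "\<dots> = 0" unfolding R2 by simp
  finally show "(\<mu> * p - lam * z) * (lam + \<beta> - lam * z) = \<alpha> * lam * z"
    by (simp add: m_def)
qed

theorem proposition2p4:
  fixes lam \<mu> \<alpha> \<beta> p :: real and \<pi> :: "state pmf"
  assumes "lam > 0" "\<mu> > 0" "\<alpha> > 0" "\<beta> > 0"
    and "0 < p" "p \<le> 1"
    and "lam < \<beta> / (\<alpha> + \<beta>) * \<mu> * p"
    and "stationary (rate lam \<mu> \<alpha> \<beta> p) \<pi>"
  shows "0 < gamma_p lam \<mu> \<alpha> \<beta> p \<and> gamma_p lam \<mu> \<alpha> \<beta> p < 1 \<and>
    (\<forall>y. \<exists>C_U>0. \<exists>C_D>0.
       (\<lambda>k. pmf \<pi> (k, y, Up)) \<sim>[sequentially] (\<lambda>k. C_U * gamma_p lam \<mu> \<alpha> \<beta> p ^ k) \<and>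
       (\<lambda>k. pmf \<pi> (k, y, Down)) \<sim>[sequentially] (\<lambda>k. C_D * gamma_p lam \<mu> \<alpha> \<beta> p ^ k))"
proof -
  define z where "z = 1 / gamma_p lam \<mu> \<alpha> \<beta> p"
  have root: "1 < z" "lam * z < \<mu> * p" "lam * z < lam + \<beta>"
    "(\<mu> * p - lam * z) * (lam + \<beta> - lam * z) = \<alpha> * lam * z"
    unfolding z_def by (rule gamma_p_root; fact)+
  interpret network_decay lam \<mu> \<alpha> \<beta> p \<pi> z "1 - lam * (z - 1) / \<beta>"
    by unfold_locales (fact assms root refl)+
  have gamma: "gamma_p lam \<mu> \<alpha> \<beta> p = 1 / z"
    by (simp add: z_def)
  have "0 < 1 / z" "1 / z < 1" using root(1) by simp_all
  then show ?thesis
    unfolding gamma using pmf_asymp_equiv by metis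
qed

end
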